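(* Let $\alpha\in[0,\infty]$ and $X\in\mathcal X_\alpha$. (i) If $X$ is bounded from above, that is, $x_*<\infty$, then $$\lim_{p\downarrow0}Q_\alpha(X;p)=\lim_{p\downarrow0}Q_0(X;p)=x_*\in\mathbb R.$$ (ii) If the function $x\mapsto\mathsf P(X\ge x)$ is like $x^{-r}$ for some $r\in(\alpha,\infty]$, then $x_*=\infty$, $Q_\alpha(X;p)\to\infty$ as $p\downarrow0$, and $$Q_\alpha(X;p)\sim K(r,\alpha)\,Q_0(X;p)\quad\text{as }p\downarrow0,$$ where $K(r,\alpha):=1$ if $r=\infty$, $K(r,\alpha):=c_{r,\alpha}^{1/r}$ if $r<\infty$, and $$c_{r,\alpha}:=\frac{\Gamma(\alpha+1)\Gamma(r-\alpha)}{\Gamma(r)}\,\frac{r^r}{\alpha^\alpha(r-\alpha)^{r-\alpha}}$$ (with $\alpha^\alpha:=1$ for $\alpha=0$), $\Gamma$ being the Gamma function.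
   Context: For real $u$, $u_+:=\max(0,u)$ and $u_+^\alpha:=(u_+)^\alpha$. Define $h_\alpha:\mathbb R\to\mathbb R$ by $h_0(u)=\mathsf I\{u\ge0\}$ (indicator), $h_\alpha(u)=(1+u/\alpha)_+^\alpha$ for $0<\alpha<\infty$, and $h_\infty(u)=e^u$. For a random variable $X$, $x\in\mathbb R$, $\alpha\in[0,\infty]$ and $p\in(0,1)$ put $$P_\alpha(X;x):=\inf_{\lambda\in(0,\infty)}\mathsf E\,h_\alpha(\lambda(X-x)),\qquad Q_\alpha(X;p):=\inf\{x\in\mathbb R:P_\alpha(X;x)<p\}.$$ In particular, $Q_0(X;p)=\inf\{x\in\mathbb R:\mathsf P(X\ge x)<p\}$. $\mathcal X_0$ is the set of all real-valued random variables (on a given probability space); for $\alpha\in(0,\infty)$, $\mathcal X_\alpha$ is the set of those $X$ with $\mathsf E X_+^\alpha<\infty$; $\mathcal X_\infty$ is the set of those $X$ with $\mathsf E e^{\lambda X}<\infty$ for some real $\lambda>0$. $x_*:=\sup\operatorname{supp}X\in(-\infty,\infty]$, where $\operatorname{supp}X$ is the support of the distribution of $X$. Given $r\in(0,\infty]$ and a positive function $q$ on $\mathbb R$, say that $q(x)$ is like $x^{-r}$ if there is a positive twice differentiable function $q_0$ on $\mathbb R$ such that $q(x)\sim q_0(x)$ as $x\to\infty$ and $$\lim_{x\to\infty}\frac{q_0(x)q_0''(x)}{q_0'(x)^2}=1+\frac1r$$ (with $1/\infty:=0$). Here $f\sim g$ means $f/g\to1$. *)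

theory Defs
  imports "HOL-Probability.Probability" "HOL-Library.Landau_Symbols"
begin

text \<open>The parameters \<open>\<alpha> \<in> [0, \<infinity>]\<close> and \<open>r \<in> (0, \<infinity>]\<close> are of type \<^typ>\<open>ennreal\<close>.\<close>

definition h_fun :: "ennreal \<Rightarrow> real \<Rightarrow> real" where
  "h_fun \<alpha> u =
    (if \<alpha> = 0 then (if u \<ge> 0 then 1 else 0)
     else if \<alpha> = \<infinity> then exp u
     else (max 0 (1 + u / enn2real \<alpha>)) powr enn2real \<alpha>)"

text \<open>
  The expectation of the nonnegative function \<open>h_fun \<alpha>\<close> may be infinite for some scaling factors
  \<open>t\<close>, so it is taken as a nonnegative integral rather than a Bochner integral, which would be
  \<open>0\<close> in that case.
\<close>

definition P_tail :: "'a measure \<Rightarrow> ennreal \<Rightarrow> ('a \<Rightarrow> real) \<Rightarrow> real \<Rightarrow> ennreal" where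
  "P_tail M \<alpha> X x =
    (INF t\<in>{0::real<..}. \<integral>\<^sup>+ \<omega>. ennreal (h_fun \<alpha> (t * (X \<omega> - x))) \<partial>M)"

text \<open>The infimum is taken in the extended reals, so that the infimum of the empty set is \<open>\<infinity>\<close>.\<close>

definition Q_quantile :: "'a measure \<Rightarrow> ennreal \<Rightarrow> ('a \<Rightarrow> real) \<Rightarrow> real \<Rightarrow> ereal" where
  "Q_quantile M \<alpha> X p = Inf (ereal ` {x. P_tail M \<alpha> X x < ennreal p})"

definition rv_class :: "'a measure \<Rightarrow> ennreal \<Rightarrow> ('a \<Rightarrow> real) set" where
  "rv_class M \<alpha> =
    {X \<in> borel_measurable M.
      if \<alpha> = 0 then True
      else if \<alpha> = \<infinity> then \<exists>t>0. (\<integral>\<^sup>+ \<omega>. ennreal (exp (t * X \<omega>)) \<partial>M) < \<infinity>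
      else (\<integral>\<^sup>+ \<omega>. ennreal ((max 0 (X \<omega>)) powr enn2real \<alpha>) \<partial>M) < \<infinity>}"

definition distr_support :: "'a measure \<Rightarrow> ('a \<Rightarrow> real) \<Rightarrow> real set" where
  "distr_support M X = {x. \<forall>U. open U \<longrightarrow> x \<in> U \<longrightarrow> emeasure (distr M borel X) U > 0}"

definition x_star :: "'a measure \<Rightarrow> ('a \<Rightarrow> real) \<Rightarrow> ereal" where
  "x_star M X = (SUP x\<in>distr_support M X. ereal x)"

text \<open>
  The functions \<open>q1\<close> and \<open>q2\<close> are the first and second derivatives of \<open>q0\<close>. Since the limit
  \<open>1 + 1/r\<close> is nonzero, it forces \<open>q1 x \<noteq> 0\<close> for all large \<open>x\<close>.
\<close>

definition like_power :: "ennreal \<Rightarrow> (real \<Rightarrow> real) \<Rightarrow> bool" where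
  "like_power r q \<longleftrightarrow>
    r > 0 \<and> (\<forall>x. q x > 0) \<and>
    (\<exists>q0 q1 q2 :: real \<Rightarrow> real.
      (\<forall>x. q0 x > 0) \<and>
      (\<forall>x. (q0 has_real_derivative q1 x) (at x)) \<and>
      (\<forall>x. (q1 has_real_derivative q2 x) (at x)) \<and>
      q \<sim>[at_top] q0 \<and>
      ((\<lambda>x. q0 x * q2 x / (q1 x)\<^sup>2) \<longlongrightarrow>
        (if r = \<infinity> then 1 else 1 + 1 / enn2real r)) at_top)"

text \<open>The case distinction is needed because \<^term>\<open>(0::real) powr 0 = 0\<close>.\<close>

definition c_const :: "real \<Rightarrow> real \<Rightarrow> real" where
  "c_const r \<alpha> =
    Gamma (\<alpha> + 1) * Gamma (r - \<alpha>) / Gamma r *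
    (r powr r / ((if \<alpha> = 0 then 1 else \<alpha> powr \<alpha>) * (r - \<alpha>) powr (r - \<alpha>)))"

definition K_const :: "ennreal \<Rightarrow> ennreal \<Rightarrow> real" where
  "K_const r \<alpha> =
    (if r = \<infinity> then 1
     else c_const (enn2real r) (enn2real \<alpha>) powr (1 / enn2real r))"

end

theory Submission
  imports Defs
begin

text \<open>
  Write $q(x)$ for the probability of $X \ge x$. Always $P_\alpha(X;x) \ge q(x)$, and
  $P_\alpha(X;x) = 0$ for $x > x_*$, which gives (i). For (ii) it suffices to show that
  $P_\alpha(X;Lx) \le q(x)$ eventually if $L > K(r,\alpha)$ and $P_\alpha(X;Lx) \ge q(x)$
  eventually if $L < K(r,\alpha)$, since such bounds are inherited by the generalized inverses.

  The condition on $q_0$ says that $q_0/q_0'$ has a derivative tending to $-1/r$. Hence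
  $x q_0'(x)/q_0(x) \to -r$, so $x^s q_0(x)$ is eventually decreasing for $s < r$ and
  eventually increasing for $s > r$, which yields Potter bounds for $q$. With $z = x - \alpha/\lambda$
  one has $P_\alpha(X;x) = \inf_{z<x} E(X-z)_+^\alpha/(x-z)^\alpha$, and for large $z$ the Potter bounds
  compare $E((X-z)_+/z)^\alpha$ with $q(z)$ times the Pareto moment
  $\Gamma(\alpha+1)\Gamma(r-\alpha)/\Gamma(r)$. Minimizing over $z/x$ gives the other factor of
  $c_{r,\alpha}$; the minimum is at $z/x = (r-\alpha)/r$. Values of $z$ below a small multiple of $x$ do
  not matter, by Markov's inequality and $r > \alpha$.
\<close>

section \<open>Gamma integrals and the layer cake formula\<close>

text \<open>Euler's integral for \<open>Gamma a\<close> after the linear substitution t = c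
  v.\<close>

lemma nn_integral_Gamma_scaled:
  fixes a c :: real
  assumes "a > 0" "c > 0"
  shows "(\<integral>\<^sup>+v\<in>{0..}. ennreal (v powr (a - 1) * exp (- (c * v))) \<partial>lborel)
    = ennreal (Gamma a * c powr (- a))"
proof -
  let ?f = "\<lambda>t::real. ennreal (t powr (a - 1) / exp t) * indicator {0..} t"
  have m: "?f \<in> borel_measurable borel" by measurable
  have "integral\<^sup>N lborel ?f = ennreal (Gamma a)"
    using nn_integral_has_integral_lebesgue'[OF _ Gamma_integral_real[OF assms(1)]] by simp
  moreover have "integral\<^sup>N lborel ?f = ennreal \<bar>c\<bar> * (\<integral>\<^sup>+v. ?f (0 + c * v) \<partial>lborel)"
    using assms by (intro nn_integral_real_affine m) auto
  moreover have "?f (0 + c * v) = ennreal (c powr (a - 1)) *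
      (ennreal (v powr (a - 1) * exp (- (c * v))) * indicator {0..} v)" for v
    using assms by (auto simp: indicator_def zero_le_mult_iff powr_mult exp_minus field_simps
        simp flip: ennreal_mult)
  ultimately have "ennreal (Gamma a) = ennreal \<bar>c\<bar> * (ennreal (c powr (a - 1)) *
     (\<integral>\<^sup>+v\<in>{0..}. ennreal (v powr (a - 1) * exp (- (c * v))) \<partial>lborel))"
    by (simp add: nn_integral_cmult)
  also have "\<dots> = ennreal (c powr a) *
     (\<integral>\<^sup>+v\<in>{0..}. ennreal (v powr (a - 1) * exp (- (c * v))) \<partial>lborel)"
    using assms by (simp add: powr_diff mult.assoc[symmetric] flip: ennreal_mult)
  finally have "ennreal (c powr (- a)) * ennreal (Gamma a) = ennreal (c powr (- a) * c powr a) *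
     (\<integral>\<^sup>+v\<in>{0..}. ennreal (v powr (a - 1) * exp (- (c * v))) \<partial>lborel)"
    by (simp add: ennreal_mult mult.assoc)
  then show ?thesis
    using assms by (simp add: powr_minus mult.commute flip: ennreal_mult)
qed

text \<open>Writing $(1+v)^{-s}$ as a Gamma integral and applying Tonelli avoids any nonlinear
  substitution.\<close>

lemma nn_integral_beta_prime:
  fixes a s :: real
  assumes "0 < a" "a < s"
  shows "(\<integral>\<^sup>+v\<in>{0..}. ennreal (v powr (a - 1) * (1 + v) powr (- s)) \<partial>lborel)
    = ennreal (Gamma a * Gamma (s - a) / Gamma s)"
proof -
  let ?F = "\<lambda>v t::real. ennreal (v powr (a - 1)) * indicator {0..} v *
     (ennreal (t powr (s - 1) * exp (- ((1 + v) * t))) * indicator {0..} t)"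
  have Gs: "Gamma s > 0" using assms by simp
  have "ennreal (Gamma s) * (\<integral>\<^sup>+v\<in>{0..}. ennreal (v powr (a - 1) * (1 + v) powr (- s)) \<partial>lborel)
    = (\<integral>\<^sup>+v. ennreal (v powr (a - 1)) * indicator {0..} v * ennreal (Gamma s * (1 + v) powr (- s)) \<partial>lborel)"
    using Gs by (subst nn_integral_cmult[symmetric])
      (auto intro!: nn_integral_cong simp: indicator_def mult_ac simp flip: ennreal_mult)
  also have "\<dots> = (\<integral>\<^sup>+v. (\<integral>\<^sup>+t. ?F v t \<partial>lborel) \<partial>lborel)"
  proof (intro nn_integral_cong)
    fix v :: real
    show "ennreal (v powr (a - 1)) * indicator {0..} v * ennreal (Gamma s * (1 + v) powr (- s))
      = (\<integral>\<^sup>+t. ?F v t \<partial>lborel)"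
      using assms by (cases "v \<ge> 0") (simp_all add: nn_integral_cmult nn_integral_Gamma_scaled)
  qed
  also have "\<dots> = (\<integral>\<^sup>+t. (\<integral>\<^sup>+v. ?F v t \<partial>lborel) \<partial>lborel)"
    by (rule lborel_pair.Fubini'[symmetric]) measurable
  also have "\<dots> = (\<integral>\<^sup>+t. ennreal (Gamma a) *
      (ennreal (t powr (s - a - 1) * exp (- (1 * t))) * indicator {0..} t) \<partial>lborel)"
  proof (intro nn_integral_cong)
    fix t :: real
    \<comment> \<open>The factor exp(-(1 + v) t) splits as exp(-t) exp(-t v), so the inner integral
      over \<open>v\<close> is again a scaled Gamma integral.\<close>
    have eq: "?F v t = ennreal (t powr (s - 1) * exp (- t)) * indicator {0..} t *
      (ennreal (v powr (a - 1) * exp (- (t * v))) * indicator {0..} v)" for v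
      by (auto simp: indicator_def algebra_simps exp_add exp_diff exp_minus divide_simps
          simp flip: ennreal_mult)
    show "(\<integral>\<^sup>+v. ?F v t \<partial>lborel) = ennreal (Gamma a) *
      (ennreal (t powr (s - a - 1) * exp (- (1 * t))) * indicator {0..} t)"
    proof (cases "t > 0")
      case True
      have "t powr (s - 1) * t powr (- a) = t powr (s - a - 1)"
        using True by (simp add: algebra_simps flip: powr_add)
      moreover have "(\<integral>\<^sup>+v. ?F v t \<partial>lborel) = ennreal (t powr (s - 1) * exp (- t)) *
          ennreal (Gamma a * t powr (- a))"
        using True assms unfolding eq by (subst nn_integral_cmult) (auto simp: nn_integral_Gamma_scaled)
      ultimately show ?thesis using True assms
        by (simp add: mult_ac flip: ennreal_mult)
    next
      case False
      \<comment> \<open>At \<open>t = 0\<close> both sides vanish because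
        \<open>0 powr x = 0\<close>; for negative \<open>t\<close> the indicator is 0.\<close>
      then have "t = 0 \<or> t < 0" by auto
      then show ?thesis unfolding eq by auto
    qed
  qed
  also have "\<dots> = ennreal (Gamma a * Gamma (s - a))"
    using assms nn_integral_Gamma_scaled[of "s - a" 1]
    by (simp add: nn_integral_cmult ennreal_mult)
  finally have *: "ennreal (Gamma s) * (\<integral>\<^sup>+v\<in>{0..}. ennreal (v powr (a - 1) * (1 + v) powr (- s)) \<partial>lborel)
    = ennreal (Gamma a * Gamma (s - a))" (is "_ * ?I = _") .
  have "?I = ennreal (1 / Gamma s * Gamma s) * ?I" using Gs by simp
  also have "\<dots> = ennreal (1 / Gamma s) * (ennreal (Gamma s) * ?I)"
    using Gs by (subst ennreal_mult) (auto simp: mult.assoc)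
  also have "\<dots> = ennreal (Gamma a * Gamma (s - a) / Gamma s)"
    unfolding * using Gs assms by (simp flip: ennreal_mult)
  finally show ?thesis .
qed

text \<open>The positive part to the power \<open>a\<close> is the integral of a v^(a-1) over v from
  0 to Y; Tonelli then exchanges the two integrals.\<close>

lemma (in sigma_finite_measure) nn_integral_powr_layer_cake:
  fixes Y :: "'a \<Rightarrow> real" and a :: real
  assumes a: "a > 0" and [measurable]: "Y \<in> borel_measurable M"
  shows "(\<integral>\<^sup>+\<omega>. ennreal (max 0 (Y \<omega>) powr a) \<partial>M) =
    (\<integral>\<^sup>+v\<in>{0..}. ennreal (a * v powr (a - 1)) * emeasure M {\<omega>\<in>space M. v \<le> Y \<omega>} \<partial>lborel)"
proof -
  let ?F = "\<lambda>\<omega> v::real. ennreal (a * v powr (a - 1)) * indicator {0..} v *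
     indicator {v. v \<le> Y \<omega>} v"
  interpret pair_sigma_finite lborel M ..
  have 1: "ennreal (max 0 (Y \<omega>) powr a) = (\<integral>\<^sup>+v. ?F \<omega> v \<partial>lborel)" for \<omega>
  proof -
    let ?c = "max 0 (Y \<omega>)"
    have "((\<lambda>v. v powr (a - 1)) has_integral (?c powr (a - 1 + 1) / (a - 1 + 1))) {0..?c}"
      using a by (intro has_integral_powr_from_0) auto
    then have "((\<lambda>v. a * v powr (a - 1)) has_integral (?c powr a)) {0..?c}"
      using a has_integral_mult_right[of "\<lambda>v. v powr (a - 1)" "?c powr a / a" "{0..?c}" a] by simp
    then have "(\<integral>\<^sup>+v. ennreal (a * v powr (a - 1)) * indicator {0..?c} v \<partial>lborel) = ennreal (?c powr a)"
      using a by (intro nn_integral_has_integral_lebesgue') auto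
    \<comment> \<open>If Y is negative, the two indicators disagree at \<open>v = 0\<close>, where
      \<open>0 powr (a - 1) = 0\<close> makes both sides vanish.\<close>
    moreover have "ennreal (a * v powr (a - 1)) * indicator {0..?c} v = ?F \<omega> v" for v
      by (cases "v = 0") (auto simp: indicator_def)
    ultimately show ?thesis by simp
  qed
  have "(\<integral>\<^sup>+\<omega>. ennreal (max 0 (Y \<omega>) powr a) \<partial>M) = (\<integral>\<^sup>+\<omega>. (\<integral>\<^sup>+v. ?F \<omega> v \<partial>lborel) \<partial>M)"
    unfolding 1 ..
  also have "\<dots> = (\<integral>\<^sup>+v. (\<integral>\<^sup>+\<omega>. ?F \<omega> v \<partial>M) \<partial>lborel)"
  proof (rule Fubini')
    show "(\<lambda>(v, \<omega>). ?F \<omega> v) \<in> borel_measurable (lborel \<Otimes>\<^sub>M M)"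
      by (simp add: indicator_def split_beta) measurable
  qed
  also have "\<dots> = (\<integral>\<^sup>+v\<in>{0..}. ennreal (a * v powr (a - 1)) * emeasure M {\<omega>\<in>space M. v \<le> Y \<omega>} \<partial>lborel)"
  proof (intro nn_integral_cong)
    fix v :: real
    have "(\<integral>\<^sup>+\<omega>. ?F \<omega> v \<partial>M) = (\<integral>\<^sup>+\<omega>. (ennreal (a * v powr (a - 1)) * indicator {0..} v) *
        indicator {\<omega>\<in>space M. v \<le> Y \<omega>} \<omega> \<partial>M)"
      by (intro nn_integral_cong) (auto simp: indicator_def)
    also have "\<dots> = (ennreal (a * v powr (a - 1)) * indicator {0..} v) *
        emeasure M {\<omega>\<in>space M. v \<le> Y \<omega>}"
      by (rule nn_integral_cmult_indicator) measurable
    finally show "(\<integral>\<^sup>+\<omega>. ?F \<omega> v \<partial>M) =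
      ennreal (a * v powr (a - 1)) * emeasure M {\<omega>\<in>space M. v \<le> Y \<omega>} * indicator {0..} v"
      by (simp add: mult_ac)
  qed
  finally show ?thesis .
qed

section \<open>Potter bounds\<close>

text \<open>A continuous derivative without zeros beyond N has constant sign there. Since f
  decreases to values below f(N), the mean value theorem gives a point where the derivative is
  negative, so that sign is negative.\<close>

lemma deriv_neg_at_top_of_tendsto_0:
  fixes f f' f'' :: "real \<Rightarrow> real"
  assumes pos: "\<And>x. f x > 0"
    and d1: "\<And>x. (f has_real_derivative f' x) (at x)"
    and d2: "\<And>x. (f' has_real_derivative f'' x) (at x)"
    and nz: "\<forall>\<^sub>F x in at_top. f' x \<noteq> 0"
    and f0: "(f \<longlongrightarrow> 0) at_top"
  shows "\<forall>\<^sub>F x in at_top. f' x < 0"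
proof -
  obtain N where N: "\<And>x. x \<ge> N \<Longrightarrow> f' x \<noteq> 0"
    using nz by (auto simp: eventually_at_top_linorder)
  have "\<forall>\<^sub>F b in at_top. f b < f N \<and> b > N"
    using order_tendstoD(2)[OF f0 pos[of N]] eventually_gt_at_top[of N] by (rule eventually_conj)
  from eventually_happens'[OF _ this] obtain b where b: "b > N" "f b < f N"
    by auto
  obtain z where z: "z > N" "f b - f N = (b - N) * f' z"
    using MVT2[of N b f f'] b d1 by auto
  have fz: "f' z < 0"
    using z b by (smt (verit) zero_le_mult_iff)
  have "f' x < 0" if "x \<ge> N" for x
  proof (rule ccontr)
    assume "\<not> f' x < 0"
    then have x: "f' x \<ge> 0" by simp
    have cont: "isCont f' y" for y using d2 DERIV_isCont by blast
    have "\<exists>y. N \<le> y \<and> f' y = 0"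
    proof (cases "x \<le> z")
      case True
      then obtain y where "x \<le> y" "f' y = 0" using IVT2[of f' z 0 x] x fz cont by auto
      then show ?thesis using that by (intro exI[of _ y]) auto
    next
      case False
      then obtain y where "z \<le> y" "f' y = 0" using IVT[of f' z 0 x] x fz cont by auto
      then show ?thesis using z by (intro exI[of _ y]) auto
    qed
    then show False using N by auto
  qed
  then show ?thesis by (auto simp: eventually_at_top_linorder)
qed

section \<open>Potter bounds for the smooth comparison function, with \<rho> in the role of
  1/r\<close>

context
  fixes q0 q1 q2 :: "real \<Rightarrow> real" and \<rho> :: real
  assumes pos: "\<And>x. q0 x > 0"
    and d1: "\<And>x. (q0 has_real_derivative q1 x) (at x)"
    and d2: "\<And>x. (q1 has_real_derivative q2 x) (at x)"
    and lim: "((\<lambda>x. q0 x * q2 x / (q1 x)\<^sup>2) \<longlongrightarrow> 1 + \<rho>) at_top"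
    and \<rho>: "\<rho> \<ge> 0"
    and q0_0: "(q0 \<longlongrightarrow> 0) at_top"
begin

lemma eventually_q1_neg: "\<forall>\<^sub>F x in at_top. q1 x < 0"
proof (rule deriv_neg_at_top_of_tendsto_0[OF pos d1 d2 _ q0_0])
  \<comment> \<open>Division by zero yields 0, so a positive quotient excludes
    \<open>q1 x = 0\<close>.\<close>
  have "\<forall>\<^sub>F x in at_top. q0 x * q2 x / (q1 x)\<^sup>2 > 0"
    using lim \<rho> by (intro order_tendstoD) auto
  then show "\<forall>\<^sub>F x in at_top. q1 x \<noteq> 0"
    by eventually_elim auto
qed

text \<open>The derivative of $q_0/q_0'$ is $1 - q_0 q_0''/(q_0')^2$.\<close>

lemma tendsto_inverse_log_derivative: "((\<lambda>x. q0 x / q1 x / x) \<longlongrightarrow> - \<rho>) at_top"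
proof (rule lhospital_at_top_at_top)
  show "\<forall>\<^sub>F x in at_top. ((\<lambda>x. q0 x / q1 x) has_real_derivative
      (1 - q0 x * q2 x / (q1 x)\<^sup>2)) (at x)"
    using eventually_q1_neg
  proof eventually_elim
    case (elim x)
    then show ?case
      by (auto intro!: derivative_eq_intros d1 d2 simp: field_simps power2_eq_square)
  qed
  show "((\<lambda>x. (1 - q0 x * q2 x / (q1 x)\<^sup>2) / 1) \<longlongrightarrow> - \<rho>) at_top"
    using tendsto_diff[OF tendsto_const lim, of 1] by simp
  show "\<forall>\<^sub>F x in at_top. ((\<lambda>x. x) has_real_derivative 1) (at x)" by simp
  show "\<forall>\<^sub>F x::real in at_top. (1::real) \<noteq> 0" by simp
qed (rule filterlim_ident)

text \<open>The condition \<open>s * \<rho> < 1\<close> says s < r and admits every s when r is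
  infinite. By the limit of q0/(x q1), the derivative q1/q0 + s/x of ln q0 + s ln x is eventually
  nonpositive.\<close>

lemma smooth_potter_upper:
  assumes s: "s > 0" "s * \<rho> < 1"
  shows "\<exists>x0>0. \<forall>x y. x0 \<le> x \<longrightarrow> x \<le> y \<longrightarrow> q0 y \<le> q0 x * (y / x) powr (- s)"
proof -
  have "\<forall>\<^sub>F x in at_top. q0 x / q1 x / x > - (1 / s)"
    using s by (intro order_tendstoD[OF tendsto_inverse_log_derivative]) (simp add: field_simps)
  then have "\<forall>\<^sub>F x in at_top. x > 0 \<and> q1 x / q0 x + s / x \<le> 0"
    using eventually_q1_neg eventually_gt_at_top[of 0]
  proof eventually_elim
    case (elim x)
    \<comment> \<open>Clearing the denominator \<open>q1 x * x\<close> reverses the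
      inequality.\<close>
    then have neg: "q1 x * x < 0" by (intro mult_neg_pos)
    have "q0 x < - (1 / s) * (q1 x * x)"
      using elim(1) neg_less_divide_eq[OF neg] by simp
    then have "s * q0 x + x * q1 x \<le> 0"
      using s by (simp add: field_simps)
    then show ?case using elim pos[of x] by (simp add: field_simps)
  qed
  then obtain x0 where x0: "\<And>x. x \<ge> x0 \<Longrightarrow> x > 0 \<and> q1 x / q0 x + s / x \<le> 0"
    by (auto simp: eventually_at_top_linorder)
  have "q0 y \<le> q0 x * (y / x) powr (- s)" if "x0 \<le> x" "x \<le> y" for x y
  proof -
    have xy: "x > 0" "y > 0" using x0 that by auto
    have "ln (q0 x) + s * ln x \<ge> ln (q0 y) + s * ln y"
    proof (rule DERIV_nonpos_imp_nonincreasing[OF that(2)])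
      fix u assume u: "x \<le> u" "u \<le> y"
      have "((\<lambda>u. ln (q0 u) + s * ln u) has_real_derivative (q1 u / q0 u + s / u)) (at u)"
        using u xy pos[of u] by (auto intro!: derivative_eq_intros d1)
      then show "\<exists>d. ((\<lambda>u. ln (q0 u) + s * ln u) has_real_derivative d) (at u) \<and> d \<le> 0"
        using x0[of u] u that by auto
    qed
    then have "ln (q0 y) \<le> ln (q0 x * (y / x) powr (- s))"
      using xy pos[of x] by (simp add: ln_mult ln_powr ln_div algebra_simps)
    then show ?thesis using pos[of x] pos[of y] xy by (subst (asm) ln_le_cancel_iff) auto
  qed
  then show ?thesis using x0[of x0] by blast
qed

text \<open>The same logarithmic derivative with the opposite sign. The condition
  \<open>s * \<rho> > 1\<close> forces \<rho> > 0, so this bound concerns finite r.\<close>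

lemma smooth_potter_lower:
  assumes s: "s > 0" "s * \<rho> > 1"
  shows "\<exists>x0>0. \<forall>x y. x0 \<le> x \<longrightarrow> x \<le> y \<longrightarrow> q0 x * (y / x) powr (- s) \<le> q0 y"
proof -
  have "\<forall>\<^sub>F x in at_top. q0 x / q1 x / x < - (1 / s)"
    using s by (intro order_tendstoD[OF tendsto_inverse_log_derivative]) (simp add: field_simps)
  then have "\<forall>\<^sub>F x in at_top. x > 0 \<and> q1 x / q0 x + s / x \<ge> 0"
    using eventually_q1_neg eventually_gt_at_top[of 0]
  proof eventually_elim
    case (elim x)
    then have neg: "q1 x * x < 0" by (intro mult_neg_pos)
    have "- (1 / s) * (q1 x * x) < q0 x"
      using elim(1) neg_divide_less_eq[OF neg] by simp
    then have "s * q0 x + x * q1 x \<ge> 0"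
      using s by (simp add: field_simps)
    then show ?case using elim pos[of x] by (simp add: field_simps)
  qed
  then obtain x0 where x0: "\<And>x. x \<ge> x0 \<Longrightarrow> x > 0 \<and> q1 x / q0 x + s / x \<ge> 0"
    by (auto simp: eventually_at_top_linorder)
  have "q0 x * (y / x) powr (- s) \<le> q0 y" if "x0 \<le> x" "x \<le> y" for x y
  proof -
    have xy: "x > 0" "y > 0" using x0 that by auto
    have "ln (q0 x) + s * ln x \<le> ln (q0 y) + s * ln y"
    proof (rule DERIV_nonneg_imp_nondecreasing[OF that(2)])
      fix u assume u: "x \<le> u" "u \<le> y"
      have "((\<lambda>u. ln (q0 u) + s * ln u) has_real_derivative (q1 u / q0 u + s / u)) (at u)"
        using u xy pos[of u] by (auto intro!: derivative_eq_intros d1)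
      then show "\<exists>d. ((\<lambda>u. ln (q0 u) + s * ln u) has_real_derivative d) (at u) \<and> d \<ge> 0"
        using x0[of u] u that by auto
    qed
    then have "ln (q0 x * (y / x) powr (- s)) \<le> ln (q0 y)"
      using xy pos[of x] by (simp add: ln_mult ln_powr ln_div algebra_simps)
    then show ?thesis using pos[of x] pos[of y] xy by (subst (asm) ln_le_cancel_iff) auto
  qed
  then show ?thesis using x0[of x0] by blast
qed

end

section \<open>Passage to asymptotically equivalent tails: Potter bounds and dilation limits\<close>

lemma asymp_equiv_sandwich:
  fixes q q0 :: "real \<Rightarrow> real"
  assumes "q \<sim>[at_top] q0" "\<And>x. q0 x > 0" "C > 1"
  shows "\<exists>x0. \<forall>x\<ge>x0. q x \<le> C * q0 x \<and> q0 x \<le> C * q x"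
proof -
  \<comment> \<open>The definition of asymptotic equivalence reads 0/0 as 1; positivity of
    \<open>q0\<close> removes that case.\<close>
  have "(\<lambda>x. if q x = 0 \<and> q0 x = 0 then 1 else q x / q0 x) = (\<lambda>x. q x / q0 x)"
    using assms(2) by (metis less_irrefl)
  then have t: "((\<lambda>x. q x / q0 x) \<longlongrightarrow> 1) at_top"
    using assms(1) unfolding asymp_equiv_def by simp
  have "\<forall>\<^sub>F x in at_top. q x / q0 x < C" "\<forall>\<^sub>F x in at_top. q x / q0 x > 1 / C"
    using assms(3) by (intro order_tendstoD[OF t]; simp)+
  then have "\<forall>\<^sub>F x in at_top. q x \<le> C * q0 x \<and> q0 x \<le> C * q x"
  proof eventually_elim
    case (elim x)
    then show ?case using assms(2)[of x] assms(3) by (simp add: field_simps)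
  qed
  then show ?thesis by (simp add: eventually_at_top_linorder)
qed

text \<open>The real number 1/r, with 1/\<infinity> = 0: for positive s and r, the condition s < r
  becomes \<open>s * tail_exponent r < 1\<close> for finite and infinite r alike.\<close>

definition tail_exponent :: "ennreal \<Rightarrow> real" where
  "tail_exponent r = (if r = \<infinity> then 0 else 1 / enn2real r)"

lemma like_power_smooth:
  assumes "like_power r q" "(q \<longlongrightarrow> 0) at_top"
  shows "\<exists>q0 q1 q2. (\<forall>x. q0 x > 0) \<and> (\<forall>x. (q0 has_real_derivative q1 x) (at x)) \<and>
    (\<forall>x. (q1 has_real_derivative q2 x) (at x)) \<and>
    ((\<lambda>x. q0 x * q2 x / (q1 x)\<^sup>2) \<longlongrightarrow> 1 + tail_exponent r) at_top \<and>
    (q0 \<longlongrightarrow> 0) at_top \<and> q \<sim>[at_top] q0"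
proof -
  obtain q0 q1 q2 where *: "\<And>x. q0 x > 0"
    "\<And>x. (q0 has_real_derivative q1 x) (at x)"
    "\<And>x. (q1 has_real_derivative q2 x) (at x)"
    "((\<lambda>x. q0 x * q2 x / (q1 x)\<^sup>2) \<longlongrightarrow> (if r = \<infinity> then 1 else 1 + 1 / enn2real r)) at_top"
    "q \<sim>[at_top] q0"
    using assms(1) unfolding like_power_def by blast
  have q0: "(q0 \<longlongrightarrow> 0) at_top"
    using assms(2) tendsto_asymp_equiv_cong[OF *(5)] by simp
  have eq: "(if r = \<infinity> then 1 else 1 + 1 / enn2real r) = 1 + tail_exponent r"
    by (simp add: tail_exponent_def)
  show ?thesis
    using *(1-3) *(4)[unfolded eq] q0 *(5) by blast
qed

lemma tail_exponent_nonneg: "tail_exponent r \<ge> 0"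
  by (simp add: tail_exponent_def)

text \<open>Passing from q to q0 at y and back from q0 to q at x costs a factor
  \<open>sqrt C\<close> each time.\<close>

lemma like_power_potter_upper:
  assumes "like_power r q" "(q \<longlongrightarrow> 0) at_top" and s: "s > 0" "s * tail_exponent r < 1" and C: "C > 1"
  shows "\<exists>x0>0. \<forall>x y. x0 \<le> x \<longrightarrow> x \<le> y \<longrightarrow> q y \<le> C * q x * (y / x) powr (- s)"
proof -
  obtain q0 q1 q2 where q0: "\<And>x. q0 x > 0"
    "\<And>x. (q0 has_real_derivative q1 x) (at x)"
    "\<And>x. (q1 has_real_derivative q2 x) (at x)"
    "((\<lambda>x. q0 x * q2 x / (q1 x)\<^sup>2) \<longlongrightarrow> 1 + tail_exponent r) at_top"
    "(q0 \<longlongrightarrow> 0) at_top" "q \<sim>[at_top] q0"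
    using like_power_smooth[OF assms(1,2)] by blast
  obtain x1 where x1: "x1 > 0" "\<And>x y. x1 \<le> x \<Longrightarrow> x \<le> y \<Longrightarrow> q0 y \<le> q0 x * (y / x) powr (- s)"
    using smooth_potter_upper[OF q0(1-4) tail_exponent_nonneg q0(5) s] by blast
  obtain x2 where x2: "\<And>x. x2 \<le> x \<Longrightarrow> q x \<le> sqrt C * q0 x \<and> q0 x \<le> sqrt C * q x"
    using asymp_equiv_sandwich[OF q0(6,1), of "sqrt C"] C by auto
  have "q y \<le> C * q x * (y / x) powr (- s)" if "max x1 x2 \<le> x" "x \<le> y" for x y
  proof -
    have "q y \<le> sqrt C * q0 y" using x2 that by auto
    also have "\<dots> \<le> sqrt C * (q0 x * (y / x) powr (- s))"
      using x1(2)[of x y] that C by (intro mult_left_mono) auto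
    also have "\<dots> \<le> sqrt C * ((sqrt C * q x) * (y / x) powr (- s))"
      using x2[of x] that C by (intro mult_left_mono mult_right_mono) auto
    finally show ?thesis using C by (simp flip: mult.assoc)
  qed
  then show ?thesis using x1(1) by (intro exI[of _ "max x1 x2"]) auto
qed

lemma like_power_potter_lower:
  assumes "like_power r q" "(q \<longlongrightarrow> 0) at_top" and s: "s > 0" "s * tail_exponent r > 1" and C: "C > 1"
  shows "\<exists>x0>0. \<forall>x y. x0 \<le> x \<longrightarrow> x \<le> y \<longrightarrow> q x * (y / x) powr (- s) \<le> C * q y"
proof -
  obtain q0 q1 q2 where q0: "\<And>x. q0 x > 0"
    "\<And>x. (q0 has_real_derivative q1 x) (at x)"
    "\<And>x. (q1 has_real_derivative q2 x) (at x)"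
    "((\<lambda>x. q0 x * q2 x / (q1 x)\<^sup>2) \<longlongrightarrow> 1 + tail_exponent r) at_top"
    "(q0 \<longlongrightarrow> 0) at_top" "q \<sim>[at_top] q0"
    using like_power_smooth[OF assms(1,2)] by blast
  obtain x1 where x1: "x1 > 0" "\<And>x y. x1 \<le> x \<Longrightarrow> x \<le> y \<Longrightarrow> q0 x * (y / x) powr (- s) \<le> q0 y"
    using smooth_potter_lower[OF q0(1-4) tail_exponent_nonneg q0(5) s] by blast
  obtain x2 where x2: "\<And>x. x2 \<le> x \<Longrightarrow> q x \<le> sqrt C * q0 x \<and> q0 x \<le> sqrt C * q x"
    using asymp_equiv_sandwich[OF q0(6,1), of "sqrt C"] C by auto
  have "q x * (y / x) powr (- s) \<le> C * q y" if "max x1 x2 \<le> x" "x \<le> y" for x y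
  proof -
    have "q x * (y / x) powr (- s) \<le> sqrt C * q0 x * (y / x) powr (- s)"
      using x2[of x] that by (intro mult_right_mono) auto
    also have "\<dots> \<le> sqrt C * q0 y"
      using x1(2)[of x y] that C by (simp add: mult.assoc)
    also have "\<dots> \<le> sqrt C * (sqrt C * q y)"
      using x2[of y] that C by (intro mult_left_mono) auto
    finally show ?thesis using C by (simp flip: mult.assoc)
  qed
  then show ?thesis using x1(1) by (intro exI[of _ "max x1 x2"]) auto
qed

text \<open>Regular variation with index -r. Potter bounds with exponents r - e and r + e and
  constant 1 + e enclose the ratio, and e tends to 0. They compare x with a larger point, hence
  \<open>a \<ge> 1\<close>.\<close>

lemma like_power_dilation_ge_1:
  assumes "like_power r q" "(q \<longlongrightarrow> 0) at_top" "r \<noteq> \<infinity>" and a: "a \<ge> 1"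
  shows "((\<lambda>x. q (a * x) / q x) \<longlongrightarrow> a powr (- enn2real r)) at_top"
proof -
  define R where "R = enn2real r"
  have qpos: "q x > 0" for x using assms(1) by (auto simp: like_power_def)
  have R: "R > 0" "tail_exponent r = 1 / R" using assms(1,3)
    by (auto simp: R_def tail_exponent_def like_power_def enn2real_positive_iff less_top)
  have up: "\<forall>\<^sub>F x in at_top. q (a * x) / q x \<le> (1 + e) * a powr (- (R - e))" if e: "0 < e" "e < R" for e
  proof -
    obtain x0 where x0: "x0 > 0" "\<And>x y. x0 \<le> x \<Longrightarrow> x \<le> y \<Longrightarrow> q y \<le> (1 + e) * q x * (y / x) powr (- (R - e))"
      using like_power_potter_upper[OF assms(1,2), of "R - e" "1 + e"] e R by (auto simp: field_simps)
    show ?thesis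
    proof (intro eventually_at_top_linorderI[of x0])
      fix x assume x: "x \<ge> x0"
      then have "x > 0" "x \<le> a * x" using x0(1) a mult_right_mono[of 1 a x] by auto
      then show "q (a * x) / q x \<le> (1 + e) * a powr (- (R - e))"
        using x0(2)[of x "a * x"] qpos[of x] x by (simp add: field_simps)
    qed
  qed
  have lo: "\<forall>\<^sub>F x in at_top. q (a * x) / q x \<ge> a powr (- (R + e)) / (1 + e)" if e: "0 < e" for e
  proof -
    obtain x0 where x0: "x0 > 0" "\<And>x y. x0 \<le> x \<Longrightarrow> x \<le> y \<Longrightarrow> q x * (y / x) powr (- (R + e)) \<le> (1 + e) * q y"
      using like_power_potter_lower[OF assms(1,2), of "R + e" "1 + e"] e R by (auto simp: field_simps)
    show ?thesis
    proof (intro eventually_at_top_linorderI[of x0])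
      fix x assume x: "x \<ge> x0"
      then have "x > 0" "x \<le> a * x" using x0(1) a mult_right_mono[of 1 a x] by auto
      then show "q (a * x) / q x \<ge> a powr (- (R + e)) / (1 + e)"
        using x0(2)[of x "a * x"] qpos[of x] x e by (simp add: field_simps)
    qed
  qed
  show ?thesis unfolding R_def[symmetric]
  proof (rule order_tendstoI)
    fix u assume u: "u > a powr (- R)"
    have "((\<lambda>e. (1 + e) * a powr (- (R - e))) \<longlongrightarrow> (1 + 0) * a powr (- (R - 0))) (at_right 0)"
      using a by (intro tendsto_intros) auto
    then have "\<forall>\<^sub>F e in at_right 0. (1 + e) * a powr (- (R - e)) < u"
      using u by (intro order_tendstoD) auto
    moreover have "\<forall>\<^sub>F e in at_right 0. e \<in> {0<..<R}"
      using R by (intro eventually_at_right_real)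
    ultimately have "\<forall>\<^sub>F e in at_right 0. (1 + e) * a powr (- (R - e)) < u \<and> e \<in> {0<..<R}"
      by (rule eventually_conj)
    from eventually_happens'[OF _ this] obtain e where "0 < e" "e < R" "(1 + e) * a powr (- (R - e)) < u"
      by auto
    then show "\<forall>\<^sub>F x in at_top. q (a * x) / q x < u"
      by (intro eventually_mono[OF up[of e]]) auto
  next
    fix u assume u: "u < a powr (- R)"
    have "((\<lambda>e. a powr (- (R + e)) / (1 + e)) \<longlongrightarrow> a powr (- (R + 0)) / (1 + 0)) (at_right 0)"
      using a by (intro tendsto_intros) auto
    then have "\<forall>\<^sub>F e in at_right 0. a powr (- (R + e)) / (1 + e) > u"
      using u by (intro order_tendstoD) auto
    moreover have "\<forall>\<^sub>F e in at_right 0. e \<in> {0<..<R}"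
      using R by (intro eventually_at_right_real)
    ultimately have "\<forall>\<^sub>F e in at_right 0. a powr (- (R + e)) / (1 + e) > u \<and> e \<in> {0<..<R}"
      by (rule eventually_conj)
    from eventually_happens'[OF _ this] obtain e where "0 < e" "e < R" "a powr (- (R + e)) / (1 + e) > u"
      by auto
    then show "\<forall>\<^sub>F x in at_top. q (a * x) / q x > u"
      by (intro eventually_mono[OF lo[of e]]) auto
  qed
qed

text \<open>For a < 1, apply the previous case to 1/a along a x and take reciprocals.\<close>

lemma like_power_dilation:
  assumes "like_power r q" "(q \<longlongrightarrow> 0) at_top" "r \<noteq> \<infinity>" and a: "a > 0"
  shows "((\<lambda>x. q (a * x) / q x) \<longlongrightarrow> a powr (- enn2real r)) at_top"
proof (cases "a \<ge> 1")
  case True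
  then show ?thesis by (rule like_power_dilation_ge_1[OF assms(1-3)])
next
  case False
  have "((\<lambda>x. q (1 / a * x) / q x) \<longlongrightarrow> (1 / a) powr (- enn2real r)) at_top"
    using False a by (intro like_power_dilation_ge_1 assms) auto
  moreover have "LIM x at_top. a * x :> at_top"
    using a by (simp add: filterlim_tendsto_pos_mult_at_top[OF tendsto_const] filterlim_ident)
  ultimately have "((\<lambda>x. q (1 / a * (a * x)) / q (a * x)) \<longlongrightarrow> (1 / a) powr (- enn2real r)) at_top"
    by (rule filterlim_compose)
  then have "((\<lambda>x. inverse (q x / q (a * x))) \<longlongrightarrow> inverse ((1 / a) powr (- enn2real r))) at_top"
    using a by (intro tendsto_inverse) auto
  then show ?thesis using a by (simp add: powr_divide powr_minus)
qed

text \<open>For infinite r the upper Potter bound holds with every exponent s, and 2 a^(-s) becomes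
  arbitrarily small.\<close>

lemma like_power_infinity_dilation:
  assumes "like_power \<infinity> q" "(q \<longlongrightarrow> 0) at_top" and a: "a > 1"
  shows "((\<lambda>x. q (a * x) / q x) \<longlongrightarrow> 0) at_top"
proof (rule order_tendstoI)
  have qpos: "q x > 0" for x using assms(1) by (auto simp: like_power_def)
  show "\<forall>\<^sub>F x in at_top. u < q (a * x) / q x" if "u < 0" for u
    using that qpos by (intro always_eventually) (meson divide_pos_pos less_trans)
  fix u :: real assume u: "u > 0"
  \<comment> \<open>Chosen so that s ln a = |ln (2/u)| + ln a exceeds ln (2/u); absolute value and
    summand 1 keep s positive.\<close>
  define s where "s = \<bar>ln (2 / u)\<bar> / ln a + 1"
  have "ln (2 / u) < ln (a powr s)"
    using a by (simp add: s_def ln_powr distrib_right) (smt (verit) ln_gt_zero)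
  then have "2 / u < a powr s"
    using u a by (subst (asm) ln_less_cancel_iff) auto
  then have s: "s > 0" "2 * a powr (- s) < u"
    using u a by (auto simp: s_def powr_minus field_simps add_pos_nonneg)
  obtain x0 where x0: "x0 > 0" "\<And>x y. x0 \<le> x \<Longrightarrow> x \<le> y \<Longrightarrow> q y \<le> 2 * q x * (y / x) powr (- s)"
    using like_power_potter_upper[OF assms(1,2) s(1), of 2] by (auto simp: tail_exponent_def)
  show "\<forall>\<^sub>F x in at_top. q (a * x) / q x < u"
  proof (intro eventually_at_top_linorderI[of x0])
    fix x assume x: "x \<ge> x0"
    then have "x > 0" "x \<le> a * x" using x0(1) a mult_right_mono[of 1 a x] by auto
    then have "q (a * x) / q x \<le> 2 * a powr (- s)"
      using x0(2)[of x "a * x"] qpos[of x] x by (simp add: field_simps)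
    then show "q (a * x) / q x < u" using s by simp
  qed
qed

section \<open>Tails and truncated moments\<close>

text \<open>Defined as a function so that the unapplied \<open>upper_tail M X\<close> can serve as
  the argument of \<open>like_power\<close> and in limits.\<close>

definition upper_tail :: "'a measure \<Rightarrow> ('a \<Rightarrow> real) \<Rightarrow> real \<Rightarrow> real" where
  "upper_tail M X = (\<lambda>x. measure M {\<omega> \<in> space M. X \<omega> \<ge> x})"

text \<open>For 0 < a < s this is E (Y - 1)^a for a Pareto variable Y with tail y^(-s) on y \<ge>
  1.\<close>

definition pareto_moment :: "real \<Rightarrow> real \<Rightarrow> real" where
  "pareto_moment a s = Gamma (a + 1) * Gamma (s - a) / Gamma s"

lemma pareto_moment_pos: "0 < a \<Longrightarrow> a < s \<Longrightarrow> pareto_moment a s > 0"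
  by (simp add: pareto_moment_def)

lemma nn_integral_pareto_moment:
  assumes "0 < a" "a < s"
  shows "(\<integral>\<^sup>+v\<in>{0..}. ennreal (a * v powr (a - 1) * (1 + v) powr (- s)) \<partial>lborel)
    = ennreal (pareto_moment a s)"
proof -
  have "(\<integral>\<^sup>+v\<in>{0..}. ennreal (a * v powr (a - 1) * (1 + v) powr (- s)) \<partial>lborel) =
    (\<integral>\<^sup>+v. ennreal a * (ennreal (v powr (a - 1) * (1 + v) powr (- s)) * indicator {0..} v) \<partial>lborel)"
    using assms by (intro nn_integral_cong) (auto simp: mult.assoc indicator_def simp flip: ennreal_mult)
  also have "\<dots> = ennreal a * ennreal (Gamma a * Gamma (s - a) / Gamma s)"
    using assms by (subst nn_integral_cmult) (auto simp: nn_integral_beta_prime)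
  also have "\<dots> = ennreal (pareto_moment a s)"
    using assms Gamma_plus1[of a] by (simp add: pareto_moment_def add.commute nonpos_Ints_def flip: ennreal_mult)
  finally show ?thesis .
qed

section \<open>The functions h and the infimum over truncation points\<close>

lemma h_fun_mono:
  assumes "u \<le> v"
  shows "h_fun \<alpha> u \<le> h_fun \<alpha> v"
proof (cases "\<alpha> = 0 \<or> \<alpha> = \<infinity>")
  case True
  then show ?thesis using assms by (auto simp: h_fun_def)
next
  case False
  then have "enn2real \<alpha> > 0" by (auto simp: enn2real_positive_iff less_top zero_less_iff_neq_zero)
  then show ?thesis using False assms
    by (auto simp: h_fun_def intro!: powr_mono2 max.mono divide_right_mono)
qed

lemma h_fun_ge_1: "u \<ge> 0 \<Longrightarrow> h_fun \<alpha> u \<ge> 1"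
  by (auto simp: h_fun_def intro!: ge_one_powr_ge_zero)

text \<open>The scale a/(w - z) puts the point below which the truncated power vanishes at
  z.\<close>

lemma h_fun_ennreal:
  assumes "a > 0" "z < w"
  shows "h_fun (ennreal a) (a / (w - z) * (x - w)) = (max 0 (x - z) / (w - z)) powr a"
proof -
  have "1 + a / (w - z) * (x - w) / a = (x - z) / (w - z)"
    using assms by (simp add: field_simps)
  then show ?thesis
    using assms by (simp add: h_fun_def max_def divide_le_0_iff zero_le_divide_iff)
qed

lemma P_tail_antimono:
  assumes "x \<le> y"
  shows "P_tail M \<alpha> X y \<le> P_tail M \<alpha> X x"
  unfolding P_tail_def using assms
  by (intro INF_mono bexI nn_integral_mono ennreal_leI h_fun_mono mult_left_mono) auto

text \<open>The map t \<mapsto> w - a/t is a bijection from the positive reals onto the reals below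
  w; it turns the scale into the truncation point z, which can then be compared with w.\<close>

lemma P_tail_ennreal:
  assumes "a > 0"
  shows "P_tail M (ennreal a) X w =
    (INF z\<in>{..<w}. \<integral>\<^sup>+\<omega>. ennreal ((max 0 (X \<omega> - z) / (w - z)) powr a) \<partial>M)"
  unfolding P_tail_def
proof (rule INF_eq)
  fix t :: real assume "t \<in> {0<..}"
  then have t: "t > 0" by simp
  have "w - a / t < w" "a / (w - (w - a / t)) = t" using t assms by auto
  with h_fun_ennreal[OF assms this(1)]
  show "\<exists>z\<in>{..<w}. (\<integral>\<^sup>+\<omega>. ennreal ((max 0 (X \<omega> - z) / (w - z)) powr a) \<partial>M)
    \<le> (\<integral>\<^sup>+\<omega>. ennreal (h_fun (ennreal a) (t * (X \<omega> - w))) \<partial>M)"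
    by (intro bexI[of _ "w - a / t"]) auto
next
  fix z assume "z \<in> {..<w}"
  then show "\<exists>t\<in>{0<..}. (\<integral>\<^sup>+\<omega>. ennreal (h_fun (ennreal a) (t * (X \<omega> - w))) \<partial>M)
    \<le> (\<integral>\<^sup>+\<omega>. ennreal ((max 0 (X \<omega> - z) / (w - z)) powr a) \<partial>M)"
    using assms h_fun_ennreal[OF assms, of z w] by (intro bexI[of _ "a / (w - z)"]) auto
qed

section \<open>Comparison of truncated moments with Pareto moments\<close>

context prob_space
begin

context
  fixes X :: "'a \<Rightarrow> real"
  assumes X [measurable]: "X \<in> borel_measurable M"
begin

lemma emeasure_upper_tail: "emeasure M {\<omega> \<in> space M. x \<le> X \<omega>} = ennreal (upper_tail M X x)"
  by (simp add: upper_tail_def emeasure_eq_measure)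

lemma upper_tail_nonneg: "upper_tail M X x \<ge> 0"
  by (simp add: upper_tail_def)

lemma upper_tail_antimono: "x \<le> y \<Longrightarrow> upper_tail M X y \<le> upper_tail M X x"
  unfolding upper_tail_def by (rule finite_measure_mono) auto

lemma upper_tail_tendsto_0: "(upper_tail M X \<longlongrightarrow> 0) at_top"
\<comment> \<open>The distribution function gives the probability of X \<le> y, and X \<ge> x
  excludes X \<le> x - 1; the shift by -1 avoids the atom at x.\<close>
proof (rule tendsto_sandwich[where f = "\<lambda>_. 0" and h = "\<lambda>x. 1 - cdf (distr M borel X) (- 1 + x)"])
  interpret D: real_distribution "distr M borel X" by (rule real_distribution_distr) simp
  have "filterlim (\<lambda>x::real. - 1 + x) at_top at_top"
    by (rule filterlim_tendsto_add_at_top[OF tendsto_const filterlim_ident])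
  then have "((\<lambda>x. cdf (distr M borel X) (- 1 + x)) \<longlongrightarrow> 1) at_top"
    by (rule filterlim_compose[OF D.cdf_lim_at_top_prob])
  from tendsto_diff[OF tendsto_const this, of 1]
  show "((\<lambda>x. 1 - cdf (distr M borel X) (- 1 + x)) \<longlongrightarrow> 0) at_top" by simp
  have "upper_tail M X x \<le> 1 - cdf (distr M borel X) (- 1 + x)" for x
  proof -
    have "cdf (distr M borel X) (- 1 + x) = prob {\<omega>\<in>space M. X \<omega> \<le> - 1 + x}"
      by (simp add: cdf_def measure_distr vimage_def Int_def conj_commute)
    moreover have "upper_tail M X x \<le> prob (space M - {\<omega>\<in>space M. X \<omega> \<le> - 1 + x})"
      unfolding upper_tail_def by (rule finite_measure_mono) auto
    ultimately show ?thesis by (simp add: prob_compl)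
  qed
  then show "\<forall>\<^sub>F x in at_top. upper_tail M X x \<le> 1 - cdf (distr M borel X) (- 1 + x)" by simp
  show "\<forall>\<^sub>F x in at_top. 0 \<le> upper_tail M X x" by (simp add: upper_tail_nonneg)
qed simp

text \<open>Markov's inequality: for every t > 0 the integrand dominates the indicator of X \<ge>
  x.\<close>

lemma upper_tail_le_P_tail: "ennreal (upper_tail M X x) \<le> P_tail M \<alpha> X x"
  unfolding P_tail_def
proof (rule INF_greatest)
  fix t :: real assume "t \<in> {0<..}"
  then have "(\<integral>\<^sup>+\<omega>. indicator {\<omega>\<in>space M. x \<le> X \<omega>} \<omega> \<partial>M) \<le>
      (\<integral>\<^sup>+\<omega>. ennreal (h_fun \<alpha> (t * (X \<omega> - x))) \<partial>M)"
    by (intro nn_integral_mono) (auto simp: indicator_def intro!: h_fun_ge_1)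
  then show "ennreal (upper_tail M X x) \<le> (\<integral>\<^sup>+\<omega>. ennreal (h_fun \<alpha> (t * (X \<omega> - x))) \<partial>M)"
    by (simp add: emeasure_upper_tail)
qed

text \<open>The sign of t (X - x) does not depend on t > 0, so the infimum is over a
  constant.\<close>

lemma P_tail_0: "P_tail M 0 X x = ennreal (upper_tail M X x)"
proof -
  have "(\<integral>\<^sup>+\<omega>. ennreal (h_fun 0 (t * (X \<omega> - x))) \<partial>M) = ennreal (upper_tail M X x)"
    if "t \<in> {0<..}" for t
  proof -
    have "(\<integral>\<^sup>+\<omega>. ennreal (h_fun 0 (t * (X \<omega> - x))) \<partial>M) =
        (\<integral>\<^sup>+\<omega>. indicator {\<omega>\<in>space M. x \<le> X \<omega>} \<omega> \<partial>M)"
      using that by (intro nn_integral_cong) (auto simp: h_fun_def indicator_def zero_le_mult_iff)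
    then show ?thesis by (simp add: emeasure_upper_tail)
  qed
  then have "P_tail M 0 X x = (INF t\<in>{0::real<..}. ennreal (upper_tail M X x))"
    unfolding P_tail_def by (intro INF_cong) auto
  also have "\<dots> = ennreal (upper_tail M X x)" by (rule cINF_const) auto
  finally show ?thesis .
qed

lemma moment_layer_cake:
  assumes "a > 0" "z > 0"
  shows "(\<integral>\<^sup>+\<omega>. ennreal ((max 0 (X \<omega> - z) / z) powr a) \<partial>M) =
    (\<integral>\<^sup>+v\<in>{0..}. ennreal (a * v powr (a - 1) * upper_tail M X (z * (1 + v))) \<partial>lborel)"
proof -
  have "(\<integral>\<^sup>+\<omega>. ennreal ((max 0 (X \<omega> - z) / z) powr a) \<partial>M) =
      (\<integral>\<^sup>+\<omega>. ennreal (max 0 ((X \<omega> - z) / z) powr a) \<partial>M)"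
    using assms by (intro nn_integral_cong) (auto simp: max_def divide_le_0_iff zero_le_divide_iff)
  also have "\<dots> = (\<integral>\<^sup>+v\<in>{0..}. ennreal (a * v powr (a - 1)) *
      emeasure M {\<omega>\<in>space M. v \<le> (X \<omega> - z) / z} \<partial>lborel)"
    using assms by (intro nn_integral_powr_layer_cake) auto
  also have "\<dots> = (\<integral>\<^sup>+v\<in>{0..}. ennreal (a * v powr (a - 1) * upper_tail M X (z * (1 + v))) \<partial>lborel)"
  proof (intro nn_integral_cong)
    fix v :: real
    have "{\<omega>\<in>space M. v \<le> (X \<omega> - z) / z} = {\<omega>\<in>space M. z * (1 + v) \<le> X \<omega>}"
      using assms by (auto simp: field_simps)
    then show "ennreal (a * v powr (a - 1)) * emeasure M {\<omega>\<in>space M. v \<le> (X \<omega> - z) / z} * indicator {0..} v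
      = ennreal (a * v powr (a - 1) * upper_tail M X (z * (1 + v))) * indicator {0..} v"
      using assms by (simp add: emeasure_upper_tail ennreal_mult upper_tail_nonneg)
  qed
  finally show ?thesis .
qed

text \<open>In the layer cake formula the tail is evaluated at y = z (1 + v), where the hypothesis
  bounds it by C (1 + v)^(-s), that is, by C times a Pareto tail.\<close>

lemma moment_le_pareto:
  assumes "0 < a" "a < s" "z > 0" "C \<ge> 0"
    and tail: "\<And>y. z \<le> y \<Longrightarrow> upper_tail M X y \<le> C * (y / z) powr (- s)"
  shows "(\<integral>\<^sup>+\<omega>. ennreal ((max 0 (X \<omega> - z) / z) powr a) \<partial>M) \<le> ennreal (C * pareto_moment a s)"
proof -
  have "(\<integral>\<^sup>+\<omega>. ennreal ((max 0 (X \<omega> - z) / z) powr a) \<partial>M) \<le>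
    (\<integral>\<^sup>+v. ennreal C * (ennreal (a * v powr (a - 1) * (1 + v) powr (- s)) * indicator {0..} v) \<partial>lborel)"
    unfolding moment_layer_cake[OF assms(1,3)]
  proof (intro nn_integral_mono)
    fix v :: real
    show "ennreal (a * v powr (a - 1) * upper_tail M X (z * (1 + v))) * indicator {0..} v
      \<le> ennreal C * (ennreal (a * v powr (a - 1) * (1 + v) powr (- s)) * indicator {0..} v)"
    proof (cases "v \<ge> 0")
      case True
      have "z \<le> z * (1 + v)" using True assms by simp
      from tail[OF this] have "upper_tail M X (z * (1 + v)) \<le> C * (1 + v) powr (- s)"
        using assms by simp
      then have "(a * v powr (a - 1)) * upper_tail M X (z * (1 + v)) \<le>
          (a * v powr (a - 1)) * (C * (1 + v) powr (- s))"
        using assms by (intro mult_left_mono) auto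
      then show ?thesis using True assms by (simp add: mult_ac flip: ennreal_mult)
    qed simp
  qed
  also have "\<dots> = ennreal C * ennreal (pareto_moment a s)"
    using assms by (subst nn_integral_cmult) (auto simp: nn_integral_pareto_moment)
  finally show ?thesis using assms pareto_moment_pos[OF assms(1,2)] by (simp flip: ennreal_mult)
qed

lemma moment_ge_pareto:
  assumes "0 < a" "a < s" "z > 0" "C \<ge> 0"
    and tail: "\<And>y. z \<le> y \<Longrightarrow> C * (y / z) powr (- s) \<le> upper_tail M X y"
  shows "ennreal (C * pareto_moment a s) \<le> (\<integral>\<^sup>+\<omega>. ennreal ((max 0 (X \<omega> - z) / z) powr a) \<partial>M)"
proof -
  have "ennreal (C * pareto_moment a s) = ennreal C * ennreal (pareto_moment a s)"
    using assms pareto_moment_pos[OF assms(1,2)] by (simp add: ennreal_mult)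
  also have "\<dots> =
    (\<integral>\<^sup>+v. ennreal C * (ennreal (a * v powr (a - 1) * (1 + v) powr (- s)) * indicator {0..} v) \<partial>lborel)"
    using assms by (subst nn_integral_cmult) (auto simp: nn_integral_pareto_moment)
  also have "\<dots> \<le> (\<integral>\<^sup>+\<omega>. ennreal ((max 0 (X \<omega> - z) / z) powr a) \<partial>M)"
    unfolding moment_layer_cake[OF assms(1,3)]
  proof (intro nn_integral_mono)
    fix v :: real
    show "ennreal C * (ennreal (a * v powr (a - 1) * (1 + v) powr (- s)) * indicator {0..} v)
      \<le> ennreal (a * v powr (a - 1) * upper_tail M X (z * (1 + v))) * indicator {0..} v"
    proof (cases "v \<ge> 0")
      case True
      have "z \<le> z * (1 + v)" using True assms by simp
      from tail[OF this] have "C * (1 + v) powr (- s) \<le> upper_tail M X (z * (1 + v))"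
        using assms by simp
      then have "(a * v powr (a - 1)) * (C * (1 + v) powr (- s)) \<le>
          (a * v powr (a - 1)) * upper_tail M X (z * (1 + v))"
        using assms by (intro mult_left_mono) auto
      from ennreal_leI[OF this] show ?thesis
        using True assms by (simp add: mult_ac upper_tail_nonneg flip: ennreal_mult)
    qed simp
  qed
  finally show ?thesis .
qed

text \<open>Separates the dependence on z/w from the moment normalized by z, which is the one
  compared with the Pareto moment.\<close>

lemma moment_rescale:
  assumes "0 < z" "z < w"
  shows "(\<integral>\<^sup>+\<omega>. ennreal ((max 0 (X \<omega> - z) / (w - z)) powr a) \<partial>M) =
    ennreal ((z / (w - z)) powr a) * (\<integral>\<^sup>+\<omega>. ennreal ((max 0 (X \<omega> - z) / z) powr a) \<partial>M)"
proof -
  have "(max 0 (x - z) / (w - z)) powr a = (z / (w - z)) powr a * (max 0 (x - z) / z) powr a" for x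
    using assms by (subst powr_mult[symmetric]) auto
  then show ?thesis
    by (subst nn_integral_cmult[symmetric]) (auto simp: ennreal_mult)
qed

lemma P_tail_le_pareto:
  assumes "0 < a" "a < s" "0 < z" "z < w" "C \<ge> 0"
    and tail: "\<And>y. z \<le> y \<Longrightarrow> upper_tail M X y \<le> C * (y / z) powr (- s)"
  shows "P_tail M (ennreal a) X w \<le> ennreal ((z / (w - z)) powr a * (C * pareto_moment a s))"
proof -
  have "P_tail M (ennreal a) X w \<le> (\<integral>\<^sup>+\<omega>. ennreal ((max 0 (X \<omega> - z) / (w - z)) powr a) \<partial>M)"
    unfolding P_tail_ennreal[OF assms(1)] using assms by (intro INF_lower) auto
  also have "\<dots> \<le> ennreal ((z / (w - z)) powr a) * ennreal (C * pareto_moment a s)"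
    unfolding moment_rescale[OF assms(3,4)] using moment_le_pareto[OF assms(1,2,3,5) tail]
    by (intro mult_left_mono) auto
  finally show ?thesis using assms pareto_moment_pos[OF assms(1,2)] by (simp flip: ennreal_mult)
qed

lemma upper_tail_mult_le_moment:
  assumes "0 < a" "0 < \<eta>" "\<eta> < 1" "0 < w" "z \<le> \<eta> / 2 * w"
  shows "ennreal (upper_tail M X (\<eta> * w) * (\<eta> / 2) powr a) \<le>
    (\<integral>\<^sup>+\<omega>. ennreal ((max 0 (X \<omega> - z) / (w - z)) powr a) \<partial>M)"
proof -
  have "\<eta> / 2 * w < 1 * w" using assms by (intro mult_strict_right_mono) auto
  then have zw: "z < w" using assms(5) by linarith
  have "(\<eta> / 2) powr a \<le> (max 0 (x - z) / (w - z)) powr a" if "\<eta> * w \<le> x" for x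
  proof (rule powr_mono2)
    \<comment> \<open>A rearrangement of (\<eta>/2) (w - z) \<le> \<eta> w - z.\<close>
    have "(2 - \<eta>) * z \<le> \<eta> * w"
    proof (cases "z \<ge> 0")
      case True
      then have "0 \<le> \<eta> * z" using assms by simp
      then show ?thesis using assms by (simp add: left_diff_distrib)
    next
      case False
      then have "(2 - \<eta>) * z \<le> 0" using assms by (intro mult_nonneg_nonpos) auto
      also have "0 \<le> \<eta> * w" using assms by simp
      finally show ?thesis .
    qed
    then have "\<eta> / 2 * (w - z) \<le> x - z"
      using that unfolding left_diff_distrib right_diff_distrib by linarith
    also have "\<dots> \<le> max 0 (x - z)" by (rule max.cobounded2)
    finally have "\<eta> / 2 * (w - z) \<le> max 0 (x - z)" .
    then show "\<eta> / 2 \<le> max 0 (x - z) / (w - z)" using zw by (simp add: pos_le_divide_eq)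
  qed (use assms in auto)
  then have "(\<integral>\<^sup>+\<omega>. ennreal ((\<eta> / 2) powr a) * indicator {\<omega>\<in>space M. \<eta> * w \<le> X \<omega>} \<omega> \<partial>M) \<le>
    (\<integral>\<^sup>+\<omega>. ennreal ((max 0 (X \<omega> - z) / (w - z)) powr a) \<partial>M)"
    by (intro nn_integral_mono) (auto simp: indicator_def intro!: ennreal_leI)
  then show ?thesis
    by (simp add: nn_integral_cmult_indicator emeasure_upper_tail mult.commute upper_tail_nonneg flip: ennreal_mult)
qed

end

end

section \<open>The tail bounds at a dilated argument\<close>

text \<open>For 0 < a < s, the minimum of (\<theta>/(1 - \<theta>))^a \<theta>^(-s) over \<theta> in
  (0,1); the lower bound and its attainment are \<open>opt_factor_le\<close> and
  \<open>opt_factor_eq\<close>.\<close>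

definition opt_factor :: "real \<Rightarrow> real \<Rightarrow> real" where
  "opt_factor a s = s powr s / (a powr a * (s - a) powr (s - a))"

lemma opt_factor_pos: "0 < a \<Longrightarrow> a < s \<Longrightarrow> opt_factor a s > 0"
  by (simp add: opt_factor_def)

text \<open>After taking logarithms this is ln u \<le> u - 1 at u = \<theta> s/(s - a) with weight s
  - a and at u = (1 - \<theta>) s/a with weight a; the weighted right-hand sides sum to 0.\<close>

lemma opt_factor_le:
  assumes "0 < a" "a < s" "0 < \<theta>" "\<theta> < 1"
  shows "opt_factor a s \<le> (\<theta> / (1 - \<theta>)) powr a * \<theta> powr (- s)"
proof -
  have 1: "(s - a) * ln (\<theta> * s / (s - a)) \<le> (s - a) * (\<theta> * s / (s - a) - 1)"
    using assms by (intro mult_left_mono ln_le_minus_one) auto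
  have 2: "a * ln ((1 - \<theta>) * s / a) \<le> a * ((1 - \<theta>) * s / a - 1)"
    using assms by (intro mult_left_mono ln_le_minus_one) auto
  have "(s - a) * (\<theta> * s / (s - a) - 1) = \<theta> * s - (s - a)"
    "a * ((1 - \<theta>) * s / a - 1) = (1 - \<theta>) * s - a"
    using assms by (simp_all add: right_diff_distrib)
  moreover have "(1 - \<theta>) * s = s - \<theta> * s" by (simp add: left_diff_distrib)
  ultimately have "(s - a) * ln (\<theta> * s / (s - a)) + a * ln ((1 - \<theta>) * s / a) \<le> 0"
    using 1 2 by linarith
  moreover have "ln (\<theta> * s / (s - a)) = ln \<theta> + ln s - ln (s - a)"
    "ln ((1 - \<theta>) * s / a) = ln (1 - \<theta>) + ln s - ln a"
    using assms by (simp_all add: ln_mult ln_div)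
  ultimately have "(s - a) * (ln \<theta> + ln s - ln (s - a)) + a * (ln (1 - \<theta>) + ln s - ln a) \<le> 0"
    by simp
  then have "s * ln s - (a * ln a + (s - a) * ln (s - a)) \<le>
      a * (ln \<theta> - ln (1 - \<theta>)) + (- s) * ln \<theta>"
    by (simp add: algebra_simps)
  then have "ln (opt_factor a s) \<le> ln ((\<theta> / (1 - \<theta>)) powr a * \<theta> powr (- s))"
    using assms by (simp add: opt_factor_def ln_mult ln_div ln_powr)
  then show ?thesis
    using assms opt_factor_pos[of a s] by (subst (asm) ln_le_cancel_iff) auto
qed

text \<open>At this \<theta> both arguments u in the preceding proof equal 1, the equality case of
  ln u \<le> u - 1.\<close>

lemma opt_factor_eq:
  assumes "0 < a" "a < s" "\<theta> = (s - a) / s"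
  shows "(\<theta> / (1 - \<theta>)) powr a * \<theta> powr (- s) = opt_factor a s"
proof -
  have "1 - \<theta> = a / s" using assms by (simp add: diff_divide_distrib)
  then have "\<theta> / (1 - \<theta>) = (s - a) / a" using assms by simp
  then have "ln ((\<theta> / (1 - \<theta>)) powr a * \<theta> powr (- s)) = ln (opt_factor a s)"
    using assms by (simp add: opt_factor_def ln_mult ln_div ln_powr algebra_simps)
  then show ?thesis
    using assms opt_factor_pos[of a s] by (subst (asm) ln_inj_iff) auto
qed

lemma c_const_eq: "a > 0 \<Longrightarrow> c_const s a = pareto_moment a s * opt_factor a s"
  by (simp add: c_const_def pareto_moment_def opt_factor_def)

lemma c_const_0: "s > 0 \<Longrightarrow> c_const s 0 = 1"
  by (auto simp: c_const_def dest: Gamma_real_pos)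

lemma K_const_0:
  assumes "r > 0"
  shows "K_const r 0 = 1"
proof (cases "r = \<infinity>")
  case False
  then have "enn2real r > 0" using assms by (simp add: enn2real_positive_iff less_top)
  then show ?thesis using False by (simp add: K_const_def c_const_0)
qed (simp add: K_const_def)

lemma K_const_pos:
  assumes "\<alpha> < r"
  shows "K_const r \<alpha> > 0"
proof (cases "r = \<infinity>")
  case False
  obtain a where a: "\<alpha> = ennreal a" "a \<ge> 0" using assms by (cases \<alpha>) auto
  obtain s where s: "r = ennreal s" "s \<ge> 0" using False by (cases r) auto
  have as: "a < s" using assms a s by (simp add: ennreal_less_iff)
  have "c_const s a > 0"
    using as a pareto_moment_pos[of a s] opt_factor_pos[of a s]
    by (cases "a = 0") (auto simp: c_const_eq c_const_0)
  then show ?thesis using a s False by (simp add: K_const_def)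
qed (simp add: K_const_def)

text \<open>Continuity in the exponent lets the Potter exponents r - e and r + e be replaced by r in
  the limit.\<close>

lemma pareto_moment_tendsto:
  assumes "0 < a" "a < s" "(f \<longlongrightarrow> s) F"
  shows "((\<lambda>e. pareto_moment a (f e)) \<longlongrightarrow> pareto_moment a s) F"
  unfolding pareto_moment_def using assms
  by (intro tendsto_intros) (auto simp: nonpos_Ints_def Gamma_eq_zero_iff)

lemma opt_factor_tendsto:
  assumes "0 < a" "a < s" "(f \<longlongrightarrow> s) F"
  shows "((\<lambda>e. opt_factor a (f e)) \<longlongrightarrow> opt_factor a s) F"
  unfolding opt_factor_def using assms by (intro tendsto_intros) auto

lemma eventually_at_top_mult:
  fixes P :: "real \<Rightarrow> bool"
  assumes "\<forall>\<^sub>F w in at_top. P w" "L > 0"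
  shows "\<forall>\<^sub>F x in at_top. P (L * x)"
proof -
  have "LIM x at_top. L * x :> at_top"
    using assms(2) by (intro filterlim_tendsto_pos_mult_at_top[OF tendsto_const] filterlim_ident) auto
  then show ?thesis using assms(1) by (simp add: filterlim_iff)
qed

section \<open>Eventual upper and lower bounds for P under the regularity condition\<close>

context prob_space
begin

context
  fixes X :: "'a \<Rightarrow> real" and r :: ennreal
  assumes X [measurable]: "X \<in> borel_measurable M"
    and lp: "like_power r (upper_tail M X)"
begin

lemma upper_tail_pos: "upper_tail M X x > 0"
  using lp by (auto simp: like_power_def)

text \<open>The single candidate z = \<theta> w bounds the infimum from above, with the upper Potter
  bound controlling the tail beyond z.\<close>

lemma eventually_P_tail_le_dilated:
  assumes "0 < a" "a < s" "s * tail_exponent r < 1" "C > 1" "0 < \<theta>" "\<theta> < 1"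
  shows "\<forall>\<^sub>F w in at_top. P_tail M (ennreal a) X w \<le>
    ennreal ((\<theta> / (1 - \<theta>)) powr a * (C * pareto_moment a s) * upper_tail M X (\<theta> * w))"
proof -
  obtain x0 where x0: "x0 > 0"
    "\<And>x y. x0 \<le> x \<Longrightarrow> x \<le> y \<Longrightarrow> upper_tail M X y \<le> C * upper_tail M X x * (y / x) powr (- s)"
    using like_power_potter_upper[OF lp upper_tail_tendsto_0[OF X], of s C] assms by auto
  show ?thesis
  proof (intro eventually_at_top_linorderI[of "x0 / \<theta>"])
    fix w assume "w \<ge> x0 / \<theta>"
    then have w: "x0 \<le> \<theta> * w" using assms by (simp add: field_simps)
    then have "w > 0" using assms x0(1) by (metis less_le_trans zero_less_mult_pos)
    have "\<theta> * w < 1 * w" using assms \<open>w > 0\<close> by (intro mult_strict_right_mono) auto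
    have "P_tail M (ennreal a) X w \<le> ennreal ((\<theta> * w / (w - \<theta> * w)) powr a *
        (C * upper_tail M X (\<theta> * w) * pareto_moment a s))"
      using assms x0(1) w x0(2)[OF w] \<open>\<theta> * w < 1 * w\<close> upper_tail_nonneg[OF X]
      by (intro P_tail_le_pareto) auto
    moreover have "\<theta> * w / (w - \<theta> * w) = \<theta> / (1 - \<theta>)"
      using \<open>w > 0\<close> assms by (simp add: field_simps)
    ultimately show "P_tail M (ennreal a) X w \<le>
        ennreal ((\<theta> / (1 - \<theta>)) powr a * (C * pareto_moment a s) * upper_tail M X (\<theta> * w))"
      by (simp add: mult_ac)
  qed
qed

text \<open>The infimum over z is split at \<eta> w/2. Below it Markov's inequality gives the first
  entry of the minimum. Above it the lower Potter bound (exponent s') estimates the moment by q(z),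
  and the upper one (exponent s) estimates q(z) by q(w); each use costs a factor C.\<close>

lemma eventually_P_tail_ge_min:
  assumes a: "0 < a" "a < s" "a < s'" and s: "s * tail_exponent r < 1" "s' * tail_exponent r > 1"
    and C: "C > 1" and \<eta>: "0 < \<eta>" "\<eta> < 1"
  shows "\<forall>\<^sub>F w in at_top.
    ennreal (min (upper_tail M X (\<eta> * w) * (\<eta> / 2) powr a)
      (opt_factor a s * pareto_moment a s' / C\<^sup>2 * upper_tail M X w))
    \<le> P_tail M (ennreal a) X w"
proof -
  let ?q = "upper_tail M X"
  obtain x1 where x1: "x1 > 0"
    "\<And>x y. x1 \<le> x \<Longrightarrow> x \<le> y \<Longrightarrow> ?q y \<le> C * ?q x * (y / x) powr (- s)"
    using like_power_potter_upper[OF lp upper_tail_tendsto_0[OF X], of s C] assms by auto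
  obtain x2 where x2: "x2 > 0"
    "\<And>x y. x2 \<le> x \<Longrightarrow> x \<le> y \<Longrightarrow> ?q x * (y / x) powr (- s') \<le> C * ?q y"
    using like_power_potter_lower[OF lp upper_tail_tendsto_0[OF X], of s' C] assms by auto
  show ?thesis
  proof (intro eventually_at_top_linorderI[of "max x1 x2 * 2 / \<eta>"])
    fix w assume "w \<ge> max x1 x2 * 2 / \<eta>"
    then have w: "x1 \<le> \<eta> / 2 * w" "x2 \<le> \<eta> / 2 * w" using \<eta> by (auto simp: field_simps)
    then have w0: "w > 0" using \<eta> x1(1)
      by (metis half_gt_zero less_le_trans zero_less_mult_pos)
    show "ennreal (min (?q (\<eta> * w) * (\<eta> / 2) powr a)
        (opt_factor a s * pareto_moment a s' / C\<^sup>2 * ?q w)) \<le> P_tail M (ennreal a) X w"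
      unfolding P_tail_ennreal[OF a(1)]
    proof (rule INF_greatest)
      fix z assume "z \<in> {..<w}"
      then have zw: "z < w" by simp
      let ?I = "\<integral>\<^sup>+\<omega>. ennreal ((max 0 (X \<omega> - z) / (w - z)) powr a) \<partial>M"
      show "ennreal (min (?q (\<eta> * w) * (\<eta> / 2) powr a)
        (opt_factor a s * pareto_moment a s' / C\<^sup>2 * ?q w)) \<le> ?I"
      proof (cases "z \<le> \<eta> / 2 * w")
        case True
        then have "ennreal (?q (\<eta> * w) * (\<eta> / 2) powr a) \<le> ?I"
          using a \<eta> w0 by (intro upper_tail_mult_le_moment[OF X]) auto
        then show ?thesis by (rule order_trans[rotated]) (intro ennreal_leI min.cobounded1)
      next
        case False
        then have z: "x1 \<le> z" "x2 \<le> z" "z > 0" using w x1(1) by auto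
        define \<theta> where "\<theta> = z / w"
        have \<theta>: "0 < \<theta>" "\<theta> < 1" using z zw w0 by (auto simp: \<theta>_def)
        have zt: "z / (w - z) = \<theta> / (1 - \<theta>)" "(w / z) powr (- s) = 1 / \<theta> powr (- s)"
          using z zw w0 by (auto simp: \<theta>_def field_simps powr_minus powr_divide)
        have tail: "?q z / C * (y / z) powr (- s') \<le> ?q y" if "z \<le> y" for y
          using x2(2)[OF z(2) that] C by (simp add: field_simps)
        \<comment> \<open>The upper Potter bound from z to w, read as a lower bound for q(z); it
          supplies the power \<theta>^(-s) needed for \<open>opt_factor_le\<close>.\<close>
        have "?q w \<le> C * ?q z / \<theta> powr (- s)"
          using x1(2)[OF z(1), of w] zw zt by simp
        then have "\<theta> powr (- s) * ?q w / C \<le> ?q z"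
          using C \<theta> by (simp add: field_simps)
        then have "(\<theta> / (1 - \<theta>)) powr a * pareto_moment a s' / C * (\<theta> powr (- s) * ?q w / C) \<le>
            (\<theta> / (1 - \<theta>)) powr a * pareto_moment a s' / C * ?q z"
          using C pareto_moment_pos[OF a(1,3)] by (intro mult_left_mono) auto
        moreover have "opt_factor a s * (pareto_moment a s' / C\<^sup>2 * ?q w) \<le>
            (\<theta> / (1 - \<theta>)) powr a * \<theta> powr (- s) * (pareto_moment a s' / C\<^sup>2 * ?q w)"
          using C pareto_moment_pos[OF a(1,3)] upper_tail_nonneg[OF X] opt_factor_le[OF a(1,2) \<theta>]
          by (intro mult_right_mono) auto
        ultimately have "opt_factor a s * pareto_moment a s' / C\<^sup>2 * ?q w \<le>
            (z / (w - z)) powr a * (?q z / C * pareto_moment a s')"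
          unfolding zt by (simp add: power2_eq_square mult_ac)
        then have "ennreal (opt_factor a s * pareto_moment a s' / C\<^sup>2 * ?q w) \<le>
            ennreal ((z / (w - z)) powr a) * ennreal (?q z / C * pareto_moment a s')"
          by (simp add: ennreal_leI flip: ennreal_mult')
        also have "\<dots> \<le> ?I"
          unfolding moment_rescale[OF X z(3) zw]
          using a C z upper_tail_nonneg[OF X] tail
          by (intro mult_left_mono moment_ge_pareto[OF X]) auto
        finally show ?thesis by (rule order_trans[rotated]) (intro ennreal_leI min.cobounded2)
      qed
    qed
  qed
qed

lemma eventually_P_tail_le:
  assumes \<alpha>: "\<alpha> < r" and L: "L > K_const r \<alpha>"
  shows "\<forall>\<^sub>F x in at_top. P_tail M \<alpha> X (L * x) \<le> ennreal (upper_tail M X x)"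
proof -
  let ?q = "upper_tail M X"
  note q0 = upper_tail_tendsto_0[OF X]
  have L0: "L > 0" using K_const_pos[OF \<alpha>] L by simp
  obtain a where a: "\<alpha> = ennreal a" "a \<ge> 0" using \<alpha> by (cases \<alpha>) auto
  \<comment> \<open>Common last step: with w = L x the bound divided by q(x) tends to m l, so m l <
    1 suffices.\<close>
  have finish: "\<forall>\<^sub>F x in at_top. P_tail M \<alpha> X (L * x) \<le> ennreal (?q x)"
    if ev: "\<forall>\<^sub>F w in at_top. P_tail M \<alpha> X w \<le> ennreal (m * ?q (\<theta> * w))"
      and lim: "((\<lambda>x. ?q (\<theta> * L * x) / ?q x) \<longlongrightarrow> l) at_top" and ml: "m * l < 1" for m \<theta> l
  proof -
    have "((\<lambda>x. m * (?q (\<theta> * L * x) / ?q x)) \<longlongrightarrow> m * l) at_top"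
      by (intro tendsto_intros lim)
    then have "\<forall>\<^sub>F x in at_top. m * (?q (\<theta> * L * x) / ?q x) < 1"
      using ml by (rule order_tendstoD)
    then show ?thesis
      using eventually_at_top_mult[OF ev L0]
    proof eventually_elim
      case (elim x)
      then have "m * ?q (\<theta> * (L * x)) \<le> ?q x"
        using upper_tail_pos[of x] by (simp add: field_simps)
      then show ?case using elim(2) ennreal_leI order_trans by blast
    qed
  qed
  show ?thesis
  proof (cases "a = 0")
    case True
    then have L1: "L > 1" using L \<alpha> a by (simp add: K_const_0)
    show ?thesis
    proof (intro eventually_at_top_linorderI[of 0])
      fix x :: real assume "x \<ge> 0"
      then have "1 * x \<le> L * x" using L1 by (intro mult_right_mono) auto
      then show "P_tail M \<alpha> X (L * x) \<le> ennreal (?q x)"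
        using True a by (simp add: P_tail_0[OF X] ennreal_leI upper_tail_antimono[OF X])
    qed
  next
    case False
    then have a0: "a > 0" using a by simp
    show ?thesis
    proof (cases "r = \<infinity>")
      case True
      then have L1: "L > 1" using L by (simp add: K_const_def)
      \<comment> \<open>This makes \<theta> < 1 while \<theta> L = \<open>sqrt L\<close> still
        exceeds 1, so the tail ratio tends to 0 and absorbs any constant. Hence the exponent
        \<open>a + 1\<close> and the constant 2 below are arbitrary choices.\<close>
      define \<theta> where "\<theta> = 1 / sqrt L"
      have \<theta>: "0 < \<theta>" "\<theta> < 1" "\<theta> * L = sqrt L" using L1
        by (auto simp: \<theta>_def real_div_sqrt)
      have "((\<lambda>x. ?q (\<theta> * L * x) / ?q x) \<longlongrightarrow> 0) at_top"
        unfolding \<theta> using L1 like_power_infinity_dilation[OF lp[unfolded True] q0, of "sqrt L"] by simp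
      moreover have "\<forall>\<^sub>F w in at_top. P_tail M \<alpha> X w \<le>
          ennreal ((\<theta> / (1 - \<theta>)) powr a * (2 * pareto_moment a (a + 1)) * ?q (\<theta> * w))"
        unfolding a(1) using a0 \<theta> True
        by (intro eventually_P_tail_le_dilated) (auto simp: tail_exponent_def)
      ultimately show ?thesis by (intro finish) auto
    next
      case False
      define R where "R = enn2real r"
      have te: "tail_exponent r = 1 / R" using False by (simp add: tail_exponent_def R_def)
      have aR: "a < R" using \<alpha> False a unfolding R_def by (cases r) (auto simp: ennreal_less_iff)
      \<comment> \<open>The minimizer from \<open>opt_factor_eq\<close>.\<close>
      define \<theta> where "\<theta> = (R - a) / R"
      have \<theta>: "0 < \<theta>" "\<theta> < 1" using a0 aR by (auto simp: \<theta>_def)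
      define c where "c = c_const R a"
      have c: "c > 0" "c = (\<theta> / (1 - \<theta>)) powr a * \<theta> powr (- R) * pareto_moment a R"
        using a0 aR pareto_moment_pos[of a R] opt_factor_pos[of a R] opt_factor_eq[OF a0 aR \<theta>_def]
        by (auto simp: c_def c_const_eq)
      have "c powr (1 / R) < L" using L False a by (simp add: K_const_def c_def R_def)
      then have "(c powr (1 / R)) powr R < L powr R"
        using aR a by (intro powr_less_mono2) auto
      then have "c < L powr R" using aR a c(1) by (simp add: powr_powr)
      then have "c * L powr (- R) < 1" using L0 by (simp add: powr_minus field_simps)
      \<comment> \<open>At e = 0 the expression equals c L^(-R), which is below 1 because L exceeds
        c^(1/R); by continuity it stays below 1 for some small e > 0.\<close>
      moreover have "((\<lambda>e. (\<theta> / (1 - \<theta>)) powr a * ((1 + e) * pareto_moment a (R - e)) * (\<theta> * L) powr (- R))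
        \<longlongrightarrow> (\<theta> / (1 - \<theta>)) powr a * ((1 + 0) * pareto_moment a R) * (\<theta> * L) powr (- R)) (at_right 0)"
        using a0 aR by (intro tendsto_intros pareto_moment_tendsto tendsto_eq_intros) auto
      ultimately have "\<forall>\<^sub>F e in at_right 0.
          (\<theta> / (1 - \<theta>)) powr a * ((1 + e) * pareto_moment a (R - e)) * (\<theta> * L) powr (- R) < 1"
        using c(2) \<theta> L0 by (intro order_tendstoD(2)) (auto simp: powr_mult mult_ac)
      moreover have "\<forall>\<^sub>F e in at_right 0. e \<in> {0<..<R - a}"
        using aR by (intro eventually_at_right_real) auto
      ultimately have "\<forall>\<^sub>F e in at_right 0.
          (\<theta> / (1 - \<theta>)) powr a * ((1 + e) * pareto_moment a (R - e)) * (\<theta> * L) powr (- R) < 1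
          \<and> e \<in> {0<..<R - a}"
        by (rule eventually_conj)
      from eventually_happens'[OF _ this] obtain e where e: "0 < e" "e < R - a"
        "(\<theta> / (1 - \<theta>)) powr a * ((1 + e) * pareto_moment a (R - e)) * (\<theta> * L) powr (- R) < 1"
        by auto
      have "\<forall>\<^sub>F w in at_top. P_tail M \<alpha> X w \<le>
          ennreal ((\<theta> / (1 - \<theta>)) powr a * ((1 + e) * pareto_moment a (R - e)) * ?q (\<theta> * w))"
        unfolding a(1) using a0 e \<theta>
        by (intro eventually_P_tail_le_dilated) (auto simp: te field_simps)
      moreover have "((\<lambda>x. ?q (\<theta> * L * x) / ?q x) \<longlongrightarrow> (\<theta> * L) powr (- R)) at_top"
        unfolding R_def using \<theta> L0 False by (intro like_power_dilation[OF lp q0]) auto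
      ultimately show ?thesis using e(3) by (rule finish)
    qed
  qed
qed

text \<open>For finite r and positive \<alpha>, both entries of the minimum at w = L x must
  eventually exceed q(x): the second does because L < K, the first once \<eta> is small
  enough.\<close>

lemma eventually_P_tail_ge:
  assumes \<alpha>: "\<alpha> < r" and L: "0 < L" "L < K_const r \<alpha>"
  shows "\<forall>\<^sub>F x in at_top. ennreal (upper_tail M X x) \<le> P_tail M \<alpha> X (L * x)"
proof -
  let ?q = "upper_tail M X"
  note q0 = upper_tail_tendsto_0[OF X]
  obtain a where a: "\<alpha> = ennreal a" "a \<ge> 0" using \<alpha> by (cases \<alpha>) auto
  define R where "R = enn2real r"
  show ?thesis
  proof (cases "r = \<infinity> \<or> a = 0")
    case True
    \<comment> \<open>Here K = 1, so monotonicity of q and the general bound q \<le> P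
      suffice.\<close>
    have "K_const r \<alpha> = 1"
    proof (cases "r = \<infinity>")
      case False
      then show ?thesis using True \<alpha> a by (simp add: K_const_0)
    qed (simp add: K_const_def)
    then have L1: "L < 1" using L by simp
    show ?thesis
    proof (intro eventually_at_top_linorderI[of 0])
      fix x :: real assume "x \<ge> 0"
      then have "L * x \<le> 1 * x" using L1 by (intro mult_right_mono) auto
      then have "ennreal (?q x) \<le> ennreal (?q (L * x))"
        by (simp add: ennreal_leI upper_tail_antimono[OF X])
      then show "ennreal (?q x) \<le> P_tail M \<alpha> X (L * x)"
        using upper_tail_le_P_tail[OF X] by (rule order_trans)
    qed
  next
    case False
    have te: "tail_exponent r = 1 / R" using False by (simp add: tail_exponent_def R_def)
    have aR: "a < R" using \<alpha> False a unfolding R_def by (cases r) (auto simp: ennreal_less_iff)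
    have a0: "a > 0" using False a by simp
    define c where "c = c_const R a"
    have c: "c > 0" "c = opt_factor a R * pareto_moment a R"
      using a0 aR pareto_moment_pos[of a R] opt_factor_pos[of a R]
      by (auto simp: c_def c_const_eq)
    have "L < c powr (1 / R)" using L False a by (simp add: K_const_def c_def R_def)
    then have "L powr R < (c powr (1 / R)) powr R"
      using aR a L by (intro powr_less_mono2) auto
    then have cL: "c * L powr (- R) > 1"
      using aR a c L by (simp add: powr_powr powr_minus field_simps)
    have "((\<lambda>e. opt_factor a (R - e) * pareto_moment a (R + e) / (1 + e)\<^sup>2 * L powr (- R))
      \<longlongrightarrow> opt_factor a R * pareto_moment a R / (1 + 0)\<^sup>2 * L powr (- R)) (at_right 0)"
      using a0 aR by (intro tendsto_intros pareto_moment_tendsto opt_factor_tendsto tendsto_eq_intros) auto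
    then have "\<forall>\<^sub>F e in at_right 0.
        opt_factor a (R - e) * pareto_moment a (R + e) / (1 + e)\<^sup>2 * L powr (- R) > 1"
      using c(2) cL by (intro order_tendstoD(1)) auto
    moreover have "\<forall>\<^sub>F e in at_right 0. e \<in> {0<..<R - a}"
      using aR by (intro eventually_at_right_real) auto
    ultimately have "\<forall>\<^sub>F e in at_right 0.
        opt_factor a (R - e) * pareto_moment a (R + e) / (1 + e)\<^sup>2 * L powr (- R) > 1
        \<and> e \<in> {0<..<R - a}"
      by (rule eventually_conj)
    from eventually_happens'[OF _ this] obtain e where e: "0 < e" "e < R - a"
      "opt_factor a (R - e) * pareto_moment a (R + e) / (1 + e)\<^sup>2 * L powr (- R) > 1"
      by auto
    define D where "D = (1 / 2) powr a * L powr (- R)"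
    \<comment> \<open>The limit of the first entry over q(x) is D \<eta>^(a - R), which exceeds 1
      exactly when \<eta>^(R - a) < D. Since a < R, small \<eta> achieves this; D/2 gives the strict
      inequality.\<close>
    define \<eta> where "\<eta> = min (1 / 2) ((D / 2) powr (1 / (R - a)))"
    have D: "D > 0" using L by (simp add: D_def)
    then have \<eta>: "0 < \<eta>" "\<eta> < 1" by (auto simp: \<eta>_def)
    have "\<eta> powr (R - a) \<le> ((D / 2) powr (1 / (R - a))) powr (R - a)"
      using \<eta> aR by (intro powr_mono2) (auto simp: \<eta>_def)
    then have "\<eta> powr (R - a) < D" using aR D by (simp add: powr_powr)
    then have \<eta>D: "(\<eta> / 2) powr a * (\<eta> * L) powr (- R) > 1"
      using \<eta> L by (simp add: D_def powr_mult powr_divide powr_diff powr_minus field_simps)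
    have lim: "((\<lambda>x. ?q (l * x) / ?q x) \<longlongrightarrow> l powr (- R)) at_top" if "l > 0" for l
      unfolding R_def using that False by (intro like_power_dilation[OF lp q0]) auto
    have "((\<lambda>x. (\<eta> / 2) powr a * (?q (\<eta> * L * x) / ?q x)) \<longlongrightarrow> (\<eta> / 2) powr a * (\<eta> * L) powr (- R)) at_top"
      using \<eta> L by (intro tendsto_intros lim) auto
    then have 1: "\<forall>\<^sub>F x in at_top. (\<eta> / 2) powr a * (?q (\<eta> * L * x) / ?q x) > 1"
      using \<eta>D by (rule order_tendstoD)
    have "((\<lambda>x. opt_factor a (R - e) * pareto_moment a (R + e) / (1 + e)\<^sup>2 * (?q (L * x) / ?q x)) \<longlongrightarrow>
        opt_factor a (R - e) * pareto_moment a (R + e) / (1 + e)\<^sup>2 * L powr (- R)) at_top"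
      using L by (intro tendsto_mult tendsto_const lim) auto
    then have 2: "\<forall>\<^sub>F x in at_top. opt_factor a (R - e) * pareto_moment a (R + e) / (1 + e)\<^sup>2 * (?q (L * x) / ?q x) > 1"
      using e(3) by (rule order_tendstoD)
    have "\<forall>\<^sub>F w in at_top.
      ennreal (min (?q (\<eta> * w) * (\<eta> / 2) powr a)
        (opt_factor a (R - e) * pareto_moment a (R + e) / (1 + e)\<^sup>2 * ?q w))
      \<le> P_tail M \<alpha> X w"
      unfolding a(1) using a0 aR e \<eta> by (intro eventually_P_tail_ge_min) (auto simp: te field_simps)
    from eventually_at_top_mult[OF this L(1)] 1 2
    show ?thesis
    proof eventually_elim
      case (elim x)
      let ?g = "opt_factor a (R - e) * pareto_moment a (R + e) / (1 + e)\<^sup>2"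
      have *: "v \<le> g * u" if "1 < g * (u / v)" "v > 0" for g u v :: real
        using that by (simp add: field_simps)
      have "?q x \<le> ?q (\<eta> * (L * x)) * (\<eta> / 2) powr a"
        using *[OF elim(2) upper_tail_pos] by (simp add: mult_ac)
      moreover have "?q x \<le> ?g * ?q (L * x)"
        by (rule *[OF elim(3) upper_tail_pos])
      ultimately have "ennreal (?q x) \<le> ennreal (min (?q (\<eta> * (L * x)) * (\<eta> / 2) powr a) (?g * ?q (L * x)))"
        by (intro ennreal_leI) auto
      then show ?case using elim(1) by (rule order_trans)
    qed
  qed
qed

end

end

section \<open>Quantiles\<close>

lemma Q_quantile_ge:
  assumes "\<And>x. x < y \<Longrightarrow> ennreal p \<le> P_tail M \<alpha> X x"
  shows "ereal y \<le> Q_quantile M \<alpha> X p"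
  unfolding Q_quantile_def
proof (rule Inf_greatest)
  fix u assume "u \<in> ereal ` {x. P_tail M \<alpha> X x < ennreal p}"
  then obtain x where "u = ereal x" "P_tail M \<alpha> X x < ennreal p" by auto
  then show "ereal y \<le> u" using assms[of x] by (cases "x < y") auto
qed

lemma Q_quantile_le:
  assumes "P_tail M \<alpha> X x < ennreal p"
  shows "Q_quantile M \<alpha> X p \<le> ereal x"
  unfolding Q_quantile_def using assms by (intro Inf_lower) auto

section \<open>Support of the distribution and quantiles in the bounded case\<close>

context prob_space
begin

context
  fixes X :: "'a \<Rightarrow> real"
  assumes X [measurable]: "X \<in> borel_measurable M"
begin

lemma Q_quantile_ge_of_le_upper_tail:
  assumes "p \<le> upper_tail M X x"
  shows "ereal x \<le> Q_quantile M \<alpha> X p"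
proof (rule Q_quantile_ge)
  fix y assume "y < x"
  have "ennreal p \<le> ennreal (upper_tail M X x)" using assms by (rule ennreal_leI)
  also have "\<dots> \<le> P_tail M \<alpha> X x" by (rule upper_tail_le_P_tail[OF X])
  also have "\<dots> \<le> P_tail M \<alpha> X y" using \<open>y < x\<close> by (intro P_tail_antimono) auto
  finally show "ennreal p \<le> P_tail M \<alpha> X y" .
qed

lemma eventually_Q_quantile_ge:
  assumes "upper_tail M X x > 0"
  shows "\<forall>\<^sub>F p in at_right 0. ereal x \<le> Q_quantile M \<alpha> X p"
proof -
  have "\<forall>\<^sub>F p in at_right 0. p \<in> {0<..<upper_tail M X x}"
    using assms by (rule eventually_at_right_real)
  then show ?thesis
    by eventually_elim (auto intro!: Q_quantile_ge_of_le_upper_tail)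
qed

text \<open>Second countability: the complement of the support is covered by the countably many
  basic open sets of measure zero.\<close>

lemma AE_distr_support: "AE \<omega> in M. X \<omega> \<in> distr_support M X"
proof -
  obtain B :: "real set set" where B: "countable B" "topological_basis B"
    using ex_countable_basis by auto
  define N where "N = {b\<in>B. emeasure (distr M borel X) b = 0}"
  have "\<Union>N \<in> null_sets (distr M borel X)"
  proof (rule null_sets_UN'[of N "\<lambda>b. b", simplified])
    show "countable N" using B(1) by (auto simp: N_def)
    fix b assume "b \<in> N"
    then show "b \<in> null_sets (distr M borel X)"
      using topological_basis_open[OF B(2)] by (auto simp: N_def null_sets_def)
  qed
  moreover have "{x\<in>space (distr M borel X). x \<notin> distr_support M X} \<subseteq> \<Union>N"
  proof
    fix x assume "x \<in> {x\<in>space (distr M borel X). x \<notin> distr_support M X}"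
    then obtain U where U: "open U" "x \<in> U" "emeasure (distr M borel X) U = 0"
      by (auto simp: distr_support_def)
    obtain b where b: "b \<in> B" "x \<in> b" "b \<subseteq> U"
      using topological_basisE[OF B(2) U(1,2)] .
    have "emeasure (distr M borel X) b \<le> emeasure (distr M borel X) U"
      using b U by (intro emeasure_mono) auto
    then have "b \<in> N" using b U by (simp add: N_def)
    then show "x \<in> \<Union>N" using b by auto
  qed
  ultimately have "AE x in distr M borel X. x \<in> distr_support M X"
    by (rule AE_I'[rotated 0])
  then show ?thesis
    by (rule AE_distrD[rotated]) simp
qed

lemma upper_tail_pos_of_less_x_star:
  assumes "ereal x < x_star M X"
  shows "upper_tail M X x > 0"
proof -
  obtain y where y: "y \<in> distr_support M X" "x < y"
    using assms by (auto simp: x_star_def less_SUP_iff)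
  then have "0 < emeasure (distr M borel X) {x<..}" by (auto simp: distr_support_def)
  also have "\<dots> = emeasure M {\<omega>\<in>space M. x < X \<omega>}"
    by (simp add: emeasure_distr vimage_def Int_def conj_commute)
  also have "\<dots> \<le> emeasure M {\<omega>\<in>space M. x \<le> X \<omega>}"
    by (intro emeasure_mono) auto
  also have "\<dots> = ennreal (upper_tail M X x)" by (rule emeasure_upper_tail[OF X])
  finally show ?thesis by simp
qed

lemma AE_le_x_star: "AE \<omega> in M. ereal (X \<omega>) \<le> x_star M X"
  using AE_distr_support by eventually_elim (auto simp: x_star_def intro: SUP_upper)

lemma x_star_real:
  assumes "x_star M X < \<infinity>"
  obtains b where "x_star M X = ereal b" "AE \<omega> in M. X \<omega> \<le> b"
proof -
  \<comment> \<open>An empty support would have supremum -\<infinity>, contradicting that X lies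
    almost surely in it.\<close>
  have "x_star M X \<noteq> - \<infinity>"
  proof
    assume "x_star M X = - \<infinity>"
    with AE_le_x_star have "AE \<omega> in M. False" by simp
    then show False by simp
  qed
  then obtain b where b: "x_star M X = ereal b" using assms by (cases "x_star M X") auto
  show thesis using that[OF b] AE_le_x_star unfolding b by simp
qed

lemma x_star_eq_infinity:
  assumes "\<And>x. upper_tail M X x > 0"
  shows "x_star M X = \<infinity>"
proof (rule ccontr)
  assume "x_star M X \<noteq> \<infinity>"
  then obtain b where b: "AE \<omega> in M. X \<omega> \<le> b" using x_star_real by auto
  then have "AE \<omega> in M. \<not> b + 1 \<le> X \<omega>" by eventually_elim auto
  then have "upper_tail M X (b + 1) = 0"
    unfolding upper_tail_def by (intro prob_eq_0[THEN iffD2]) auto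
  then show False using assms[of "b + 1"] by simp
qed

lemma h_fun_tendsto_at_bot: "((\<lambda>t. h_fun \<alpha> (t * - d)) \<longlongrightarrow> 0) at_top" if d: "d > 0" for d :: real
proof (cases "\<alpha> = \<infinity>")
  case True
  have "LIM t at_top. - d * t :> at_bot"
    using d by (intro filterlim_tendsto_neg_mult_at_bot[OF tendsto_const] filterlim_ident) auto
  then have "((\<lambda>t. exp (- d * t)) \<longlongrightarrow> 0) at_top"
    by (rule filterlim_compose[OF exp_at_bot])
  then show ?thesis using True by (simp add: h_fun_def mult.commute)
next
  case False
  \<comment> \<open>For finite \<alpha> the function is not just small but 0 as soon as t is
    positive and exceeds \<alpha>/d.\<close>
  have "\<forall>\<^sub>F t in at_top. h_fun \<alpha> (t * - d) = 0"
    using eventually_gt_at_top[of "enn2real \<alpha> / d"] eventually_gt_at_top[of 0]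
  proof eventually_elim
    case (elim t)
    show ?case
    proof (cases "\<alpha> = 0")
      case True
      then show ?thesis using elim d by (auto simp: h_fun_def zero_le_mult_iff mult_le_0_iff)
    next
      case a0: False
      then have "enn2real \<alpha> > 0"
        using False by (auto simp: enn2real_positive_iff less_top zero_less_iff_neq_zero)
      then have "1 + t * - d / enn2real \<alpha> \<le> 0" using elim d by (simp add: field_simps)
      then have "max 0 (1 + t * - d / enn2real \<alpha>) = 0" by simp
      then show ?thesis using a0 False unfolding h_fun_def by simp
    qed
  qed
  then show ?thesis by (rule tendsto_eventually)
qed

text \<open>Almost surely X - x is at most -(x - b) < 0, so the expectation is at most h at -t (x -
  b), which tends to 0 as t grows.\<close>

lemma P_tail_eq_0:
  assumes "AE \<omega> in M. X \<omega> \<le> b" "b < x"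
  shows "P_tail M \<alpha> X x = 0"
proof (rule ccontr)
  assume "P_tail M \<alpha> X x \<noteq> 0"
  then have pos: "P_tail M \<alpha> X x > 0" by (simp add: zero_less_iff_neq_zero)
  have le: "P_tail M \<alpha> X x \<le> ennreal (h_fun \<alpha> (t * - (x - b)))" if "t > 0" for t
  proof -
    have "P_tail M \<alpha> X x \<le> (\<integral>\<^sup>+\<omega>. ennreal (h_fun \<alpha> (t * (X \<omega> - x))) \<partial>M)"
      unfolding P_tail_def using that by (intro INF_lower) auto
    also have "\<dots> \<le> (\<integral>\<^sup>+\<omega>. ennreal (h_fun \<alpha> (t * - (x - b))) \<partial>M)"
      using assms(1) that
      by (intro nn_integral_mono_AE) (auto elim!: eventually_mono intro!: ennreal_leI h_fun_mono mult_left_mono)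
    finally show ?thesis by (simp add: emeasure_space_1)
  qed
  have "((\<lambda>t. ennreal (h_fun \<alpha> (t * - (x - b)))) \<longlongrightarrow> ennreal 0) at_top"
    using h_fun_tendsto_at_bot[of "x - b"] assms(2) by (intro tendsto_ennrealI) auto
  then have "\<forall>\<^sub>F t in at_top. ennreal (h_fun \<alpha> (t * - (x - b))) < P_tail M \<alpha> X x"
    using pos by (intro order_tendstoD) auto
  then have "\<forall>\<^sub>F t::real in at_top. False"
    using eventually_gt_at_top[of 0]
  proof eventually_elim
    case (elim t)
    then show ?case using le[of t] by simp
  qed
  then show False by simp
qed

text \<open>Below x_* the tail is positive, hence at least p for small p; above x_* the infimum is
  0, hence below every p > 0. The argument is uniform in \<alpha>, so both limits in (i) are
  instances.\<close>

lemma Q_quantile_tendsto_x_star: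
  assumes "x_star M X < \<infinity>"
  shows "(Q_quantile M \<alpha> X \<longlongrightarrow> x_star M X) (at_right 0)"
proof -
  obtain b where b: "x_star M X = ereal b" "AE \<omega> in M. X \<omega> \<le> b"
    using x_star_real[OF assms] .
  show ?thesis
  proof (rule order_tendstoI)
    fix u assume "u < x_star M X"
    then obtain x where x: "u < ereal x" "ereal x < x_star M X"
      using ereal_dense2 by blast
    have "\<forall>\<^sub>F p in at_right 0. ereal x \<le> Q_quantile M \<alpha> X p"
      by (intro eventually_Q_quantile_ge upper_tail_pos_of_less_x_star x)
    then show "\<forall>\<^sub>F p in at_right 0. u < Q_quantile M \<alpha> X p"
      by eventually_elim (use x in \<open>auto intro: less_le_trans\<close>)
  next
    fix u assume "x_star M X < u"
    then obtain x where x: "x_star M X < ereal x" "ereal x < u"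
      using ereal_dense2 by blast
    have "\<forall>\<^sub>F p in at_right (0::real). p > 0" by (rule eventually_at_right_less)
    then show "\<forall>\<^sub>F p in at_right 0. Q_quantile M \<alpha> X p < u"
    proof eventually_elim
      case (elim p)
      then have "Q_quantile M \<alpha> X p \<le> ereal x"
        using P_tail_eq_0[OF b(2), of x \<alpha>] x b by (intro Q_quantile_le) simp
      then show ?case using x(2) by (rule le_less_trans)
    qed
  qed
qed

section \<open>Quantiles in the unbounded case and their ratio\<close>

lemma Q_quantile_tendsto_infinity:
  assumes "\<And>x. upper_tail M X x > 0"
  shows "(Q_quantile M \<alpha> X \<longlongrightarrow> \<infinity>) (at_right 0)"
  unfolding tendsto_PInfty
proof
  fix b
  show "\<forall>\<^sub>F p in at_right 0. ereal b < Q_quantile M \<alpha> X p"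
    using eventually_Q_quantile_ge[OF assms, of "b + 1"]
    by eventually_elim (auto intro: less_le_trans[of _ "ereal (b + 1)"])
qed

text \<open>A finite quantile y separates the points with tail at least p from those with tail below
  p; nothing is asserted at y itself.\<close>

lemma Q_quantile_0_real:
  assumes pos: "\<And>x. upper_tail M X x > 0" and "p > 0" "ereal x \<le> Q_quantile M 0 X p"
  obtains y where "Q_quantile M 0 X p = ereal y" "x \<le> y"
    "\<And>u. u < y \<Longrightarrow> p \<le> upper_tail M X u" "\<And>u. y < u \<Longrightarrow> upper_tail M X u < p"
proof -
  have "\<forall>\<^sub>F u in at_top. upper_tail M X u < p"
    using upper_tail_tendsto_0[OF X] assms(2) by (rule order_tendstoD)
  from eventually_happens'[OF _ this] obtain v where v: "upper_tail M X v < p" by auto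
  have "Q_quantile M 0 X p \<le> ereal v"
    using v assms(2) by (intro Q_quantile_le) (simp add: P_tail_0[OF X] ennreal_lessI)
  then obtain y where y: "Q_quantile M 0 X p = ereal y"
    using assms(3) by (cases "Q_quantile M 0 X p") auto
  show thesis
  proof
    show "Q_quantile M 0 X p = ereal y" by fact
    show "x \<le> y" using assms(3) y by simp
    show "p \<le> upper_tail M X u" if "u < y" for u
    proof (rule ccontr)
      assume "\<not> p \<le> upper_tail M X u"
      then have "Q_quantile M 0 X p \<le> ereal u"
        using assms(2) by (intro Q_quantile_le) (simp add: P_tail_0[OF X] ennreal_lessI)
      then show False using y that by simp
    qed
    show "upper_tail M X u < p" if "y < u" for u
    proof (rule ccontr)
      assume "\<not> upper_tail M X u < p"
      then have "ereal u \<le> Q_quantile M 0 X p" by (intro Q_quantile_ge_of_le_upper_tail) simp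
      then show False using y that by simp
    qed
  qed
qed

text \<open>Inverts the tail bounds: for l < K < L and small p, the \<alpha>-quantile lies between l
  y and L y, where y is the 0-quantile. Letting l and L approach K gives the ratio.\<close>

lemma Q_quantile_ratio:
  assumes pos: "\<And>x. upper_tail M X x > 0" and K: "K > 0"
    and A: "\<And>L. L > K \<Longrightarrow> \<forall>\<^sub>F x in at_top. P_tail M \<alpha> X (L * x) \<le> ennreal (upper_tail M X x)"
    and B: "\<And>L. 0 < L \<Longrightarrow> L < K \<Longrightarrow> \<forall>\<^sub>F x in at_top. ennreal (upper_tail M X x) \<le> P_tail M \<alpha> X (L * x)"
  shows "((\<lambda>p. Q_quantile M \<alpha> X p / (ereal K * Q_quantile M 0 X p)) \<longlongrightarrow> 1) (at_right 0)"
proof -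
  have main: "\<forall>\<^sub>F p in at_right 0. \<exists>y b. Q_quantile M 0 X p = ereal y \<and> 0 < y \<and>
      Q_quantile M \<alpha> X p = ereal b \<and> l * y \<le> b \<and> b \<le> L * y"
    if l: "0 < l" "l < K" and L: "L > K" for l L
  proof -
    obtain x0 where x0: "\<And>x. x \<ge> x0 \<Longrightarrow> P_tail M \<alpha> X (L * x) \<le> ennreal (upper_tail M X x)"
      using A[OF L] by (auto simp: eventually_at_top_linorder)
    obtain x1 where x1: "\<And>x. x \<ge> x1 \<Longrightarrow> ennreal (upper_tail M X x) \<le> P_tail M \<alpha> X (l * x)"
      using B[OF l] by (auto simp: eventually_at_top_linorder)
    \<comment> \<open>A 0-quantile y \<ge> m is positive, at least x0 and strictly above x1;
      strictness is what leaves room for \<open>u < y\<close> below.\<close>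
    define m where "m = max 1 (max x0 (x1 + 1))"
    have "\<forall>\<^sub>F p in at_right (0::real). p > 0" by (rule eventually_at_right_less)
    with eventually_Q_quantile_ge[where \<alpha> = 0, OF pos, of m] show ?thesis
    proof eventually_elim
      case (elim p)
      obtain y where y: "Q_quantile M 0 X p = ereal y" "m \<le> y"
        "\<And>u. u < y \<Longrightarrow> p \<le> upper_tail M X u" "\<And>u. y < u \<Longrightarrow> upper_tail M X u < p"
        using Q_quantile_0_real[OF pos elim(2,1)] by blast
      have "ereal (l * y) \<le> Q_quantile M \<alpha> X p"
      proof (rule Q_quantile_ge)
        fix v assume v: "v < l * y"
        \<comment> \<open>Clamping at x1 keeps the lower bound applicable, while v \<le> l u lets
          antimonotonicity transfer it to v.\<close>
        define u where "u = max x1 (v / l)"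
        have "x1 < y" "v / l < y" using v l y(2) by (auto simp: m_def field_simps)
        moreover have "l * (v / l) \<le> l * u"
          using l by (intro mult_left_mono) (auto simp: u_def)
        ultimately have u: "u < y" "x1 \<le> u" "v \<le> l * u"
          using l by (auto simp: u_def)
        have "ennreal p \<le> ennreal (upper_tail M X u)" by (intro ennreal_leI y(3) u)
        also have "\<dots> \<le> P_tail M \<alpha> X (l * u)" by (intro x1 u)
        also have "\<dots> \<le> P_tail M \<alpha> X v" by (intro P_tail_antimono u)
        finally show "ennreal p \<le> P_tail M \<alpha> X v" .
      qed
      moreover have "Q_quantile M \<alpha> X p \<le> ereal (L * y)"
      proof (rule ereal_le_epsilon2)
        fix e :: real assume e: "e > 0"
        have L0: "L > 0" using L K by simp
        \<comment> \<open>Only beyond y is the tail known to be below p; the increment e/L becomes e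
          after multiplication by L.\<close>
        define u where "u = y + e / L"
        have "e / L > 0" "x0 \<le> y" "L * (e / L) = e" using e L0 y(2) by (auto simp: m_def)
        then have u: "y < u" "x0 \<le> u" "L * u = L * y + e"
          by (auto simp: u_def distrib_left)
        have "P_tail M \<alpha> X (L * u) \<le> ennreal (upper_tail M X u)" by (intro x0 u)
        also have "\<dots> < ennreal p" using y(4)[OF u(1)] elim(2) by (intro ennreal_lessI) auto
        finally have "Q_quantile M \<alpha> X p \<le> ereal (L * u)" by (rule Q_quantile_le)
        then show "Q_quantile M \<alpha> X p \<le> ereal (L * y) + ereal e" using u by simp
      qed
      ultimately obtain b where "Q_quantile M \<alpha> X p = ereal b" "l * y \<le> b" "b \<le> L * y"
        by (cases "Q_quantile M \<alpha> X p") auto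
      then show ?case using y by (auto simp: m_def)
    qed
  qed
  show ?thesis
  proof (rule order_tendstoI)
    fix u :: ereal assume "u < 1"
    then obtain e where e: "u < ereal e" "0 < e" "e < 1"
      \<comment> \<open>Since u may be negative or -\<infinity>, the maximum with 0 makes e
        positive, so that e K is an admissible lower factor.\<close>
      using ereal_dense2[of "max 0 u" 1] by (auto simp flip: zero_ereal_def one_ereal_def)
    have "0 < e * K" "e * K < K" using e K by auto
    from main[OF this, of "K + 1"]
    show "\<forall>\<^sub>F p in at_right 0. u < Q_quantile M \<alpha> X p / (ereal K * Q_quantile M 0 X p)"
    proof (rule eventually_mono)
      fix p assume "\<exists>y b. Q_quantile M 0 X p = ereal y \<and> 0 < y \<and>
        Q_quantile M \<alpha> X p = ereal b \<and> e * K * y \<le> b \<and> b \<le> (K + 1) * y"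
      then obtain y b where "Q_quantile M 0 X p = ereal y" "0 < y"
        "Q_quantile M \<alpha> X p = ereal b" "e * K * y \<le> b" by blast
      moreover from this have "e \<le> b / (K * y)" using K by (simp add: field_simps)
      ultimately show "u < Q_quantile M \<alpha> X p / (ereal K * Q_quantile M 0 X p)"
        using e K by (auto intro: less_le_trans[of _ "ereal e"])
    qed simp
  next
    fix u :: ereal assume "u > 1"
    then obtain e where e: "ereal e < u" "1 < e"
      using ereal_dense2[of 1 u] by (auto simp flip: one_ereal_def)
    \<comment> \<open>Only the upper factor e K matters here; K/2 merely fills the slot of the lower
      factor.\<close>
    have "e * K > K" "0 < K / 2" "K / 2 < K" using e K by auto
    from main[OF this(2,3,1)]
    show "\<forall>\<^sub>F p in at_right 0. Q_quantile M \<alpha> X p / (ereal K * Q_quantile M 0 X p) < u"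
    proof (rule eventually_mono)
      fix p assume "\<exists>y b. Q_quantile M 0 X p = ereal y \<and> 0 < y \<and>
        Q_quantile M \<alpha> X p = ereal b \<and> K / 2 * y \<le> b \<and> b \<le> e * K * y"
      then obtain y b where "Q_quantile M 0 X p = ereal y" "0 < y"
        "Q_quantile M \<alpha> X p = ereal b" "b \<le> e * K * y" by blast
      moreover from this have "b / (K * y) \<le> e" using K by (simp add: field_simps)
      ultimately show "Q_quantile M \<alpha> X p / (ereal K * Q_quantile M 0 X p) < u"
        using e K by (auto intro: le_less_trans[of _ "ereal e"])
    qed
  qed
qed

end

end

theorem proposition2p7:
  fixes M :: "'a measure" and \<alpha> :: ennreal and X :: "'a \<Rightarrow> real"
  assumes "prob_space M"
    and "X \<in> rv_class M \<alpha>"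
  shows "(x_star M X < \<infinity> \<longrightarrow>
            \<bar>x_star M X\<bar> \<noteq> \<infinity> \<and>
            (Q_quantile M \<alpha> X \<longlongrightarrow> x_star M X) (at_right 0) \<and>
            (Q_quantile M 0 X \<longlongrightarrow> x_star M X) (at_right 0)) \<and>
         (\<forall>r::ennreal. \<alpha> < r \<longrightarrow>
            like_power r (\<lambda>x. measure M {\<omega> \<in> space M. X \<omega> \<ge> x}) \<longrightarrow>
            x_star M X = \<infinity> \<and>
            (Q_quantile M \<alpha> X \<longlongrightarrow> \<infinity>) (at_right 0) \<and>
            ((\<lambda>p. Q_quantile M \<alpha> X p / (ereal (K_const r \<alpha>) * Q_quantile M 0 X p))
              \<longlongrightarrow> 1) (at_right 0))"
proof -
  interpret prob_space M by fact
  have X: "X \<in> borel_measurable M" using assms(2) by (simp add: rv_class_def)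
  show ?thesis
  proof (intro conjI impI allI)
    assume fin: "x_star M X < \<infinity>"
    obtain b where "x_star M X = ereal b" using x_star_real[OF X fin] .
    then show "\<bar>x_star M X\<bar> \<noteq> \<infinity>" by simp
    show "(Q_quantile M \<alpha> X \<longlongrightarrow> x_star M X) (at_right 0)"
      "(Q_quantile M 0 X \<longlongrightarrow> x_star M X) (at_right 0)"
      by (rule Q_quantile_tendsto_x_star[OF X fin])+
  next
    fix r assume r: "\<alpha> < r" and "like_power r (\<lambda>x. measure M {\<omega> \<in> space M. X \<omega> \<ge> x})"
    then have lp: "like_power r (upper_tail M X)" by (simp add: upper_tail_def)
    note pos = upper_tail_pos[OF X lp]
    show "x_star M X = \<infinity>" by (rule x_star_eq_infinity[OF X pos])
    show "(Q_quantile M \<alpha> X \<longlongrightarrow> \<infinity>) (at_right 0)"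
      by (rule Q_quantile_tendsto_infinity[OF X pos])
    show "((\<lambda>p. Q_quantile M \<alpha> X p / (ereal (K_const r \<alpha>) * Q_quantile M 0 X p))
        \<longlongrightarrow> 1) (at_right 0)"
      by (rule Q_quantile_ratio[OF X pos K_const_pos[OF r]
        eventually_P_tail_le[OF X lp r] eventually_P_tail_ge[OF X lp r]])
  qed
qed

end
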